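(* For every cake-division instance with $n$ agents whose social graph is a line $a_1 - a_2 - \cdots - a_n$, there exists a discrete cake-cutting protocol in the Robertson–Webb query model that computes a locally envy-free allocation using at most $n^{(1+o(1))n}$ queries.
   Context: The cake is $[0,1]$. Each agent $a_i$ has a valuation $v_i$ on finite unions of subintervals of $[0,1]$ that is non-negative, additive on disjoint pieces, non-atomic (for any $[x,y]$ and $\lambda\in[0,1]$ there is $y'$ with $v_i(x,y')=\lambda v_i(x,y)$), and normalized ($v_i(0,1)=1$). An allocation is a collection $\{A_1,\dots,A_n\}$ of pairwise disjoint pieces (each a finite union of intervals) whose union is $[0,1]$, with $A_i$ given to $a_i$. Given an undirected social graph $G$ on the agents, an allocation is locally envy-free if $v_i(A_i)\ge v_i(A_j)$ for every edge $(i,j)$ of $G$. In the Robertson–Webb query model the protocol accesses valuations only through cut queries $\texttt{cut}_i(x,\tau)$ (returns $y$ with $v_i(x,y)=\tau$) and evaluation queries $\texttt{eval}_i(x,y)$ (returns $v_i(x,y)$); the query complexity counts these queries. The line graph has edges $(a_i,a_{i+1})$ for $i=1,\dots,n-1$. *)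

theory Defs
  imports Complex_Main
begin

text \<open>A valuation, given by its values v x y on intervals [x,y] of the cake [0,1]
  (the value of a finite union of interior-disjoint intervals is the sum of the values).\<close>
definition valuation :: "(real \<Rightarrow> real \<Rightarrow> real) \<Rightarrow> bool" where
  "valuation v \<longleftrightarrow>
     (\<forall>x y. 0 \<le> x \<longrightarrow> x \<le> y \<longrightarrow> y \<le> 1 \<longrightarrow> 0 \<le> v x y) \<and>
     (\<forall>x y z. 0 \<le> x \<longrightarrow> x \<le> y \<longrightarrow> y \<le> z \<longrightarrow> z \<le> 1 \<longrightarrow> v x z = v x y + v y z) \<and>
     (\<forall>x y l. 0 \<le> x \<longrightarrow> x \<le> y \<longrightarrow> y \<le> 1 \<longrightarrow> 0 \<le> l \<longrightarrow> l \<le> 1 \<longrightarrow>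
        (\<exists>y'. x \<le> y' \<and> y' \<le> y \<and> v x y' = l * v x y)) \<and>
     v 0 1 = 1"

text \<open>A piece is a finite list of intervals (a,b) with 0 <= a <= b <= 1.\<close>
type_synonym piece = "(real \<times> real) list"

definition piece_value :: "(real \<Rightarrow> real \<Rightarrow> real) \<Rightarrow> piece \<Rightarrow> real" where
  "piece_value v P = sum_list (map (\<lambda>(a,b). v a b) P)"

definition is_allocation :: "nat \<Rightarrow> (nat \<Rightarrow> piece) \<Rightarrow> bool" where
  "is_allocation n A \<longleftrightarrow>
     (\<forall>i<n. \<forall>(a,b)\<in>set (A i). 0 \<le> a \<and> a \<le> b \<and> b \<le> 1) \<and>
     (\<forall>i<n. \<forall>j<n. \<forall>p<length (A i). \<forall>q<length (A j). (i,p) \<noteq> (j,q) \<longrightarrow>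
        snd (A i ! p) \<le> fst (A j ! q) \<or> snd (A j ! q) \<le> fst (A i ! p)) \<and>
     (\<Union>i<n. \<Union>(a,b)\<in>set (A i). {a..b}) = {0..1}"

definition line_local_envy_free ::
  "nat \<Rightarrow> (nat \<Rightarrow> real \<Rightarrow> real \<Rightarrow> real) \<Rightarrow> (nat \<Rightarrow> piece) \<Rightarrow> bool" where
  "line_local_envy_free n v A \<longleftrightarrow>
     is_allocation n A \<and>
     (\<forall>i. Suc i < n \<longrightarrow>
        piece_value (v i) (A i) \<ge> piece_value (v i) (A (Suc i)) \<and>
        piece_value (v (Suc i)) (A (Suc i)) \<ge> piece_value (v (Suc i)) (A i))"

text \<open>Robertson--Webb protocols as (possibly infinitely branching) decision trees.
  Cut i x t k: query cut_i(x,t), continue with k applied to the answer.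
  Eval i x y k: query eval_i(x,y), continue with k applied to the answer.\<close>
datatype protocol =
    Output "nat \<Rightarrow> piece"
  | Cut nat real real "real \<Rightarrow> protocol"
  | Eval nat real real "real \<Rightarrow> protocol"

text \<open>rw_correct n v P k: on instance v with n agents, every query issued by P is
  well-formed and answerable, every admissible answer sequence leads to an output
  after at most k queries, and every output is a locally envy-free allocation
  for the line graph.  Cut answers may be any admissible point (adversarial oracle).\<close>
inductive rw_correct ::
  "nat \<Rightarrow> (nat \<Rightarrow> real \<Rightarrow> real \<Rightarrow> real) \<Rightarrow> protocol \<Rightarrow> nat \<Rightarrow> bool"
  for n v where
  out: "line_local_envy_free n v A \<Longrightarrow> rw_correct n v (Output A) k"
| cut: "\<lbrakk> i < n; 0 \<le> x; x \<le> 1; \<exists>y. x \<le> y \<and> y \<le> 1 \<and> v i x y = t;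
          \<forall>y. x \<le> y \<and> y \<le> 1 \<and> v i x y = t \<longrightarrow> rw_correct n v (f y) k \<rbrakk>
        \<Longrightarrow> rw_correct n v (Cut i x t f) (Suc k)"
| eval: "\<lbrakk> i < n; 0 \<le> x; x \<le> y; y \<le> 1; rw_correct n v (f (v i x y)) k \<rbrakk>
        \<Longrightarrow> rw_correct n v (Eval i x y f) (Suc k)"

end

theory Submission
  imports Defs "HOL-Library.Multiset" "HOL-Combinatorics.Transposition" "HOL-Real_Asymp.Real_Asymp"
begin

text \<open>Serve the agents from the end of the line. Suppose a cake can be divided so that every agent
  \<open>j > k\<close> has its share and agent \<open>k\<close> is left with \<open>k + 1\<close> bundles it values equally. Agent \<open>k - 1\<close>
  gives the worst bundle to agent \<open>k\<close> and trims the \<open>k\<close> others to a common value; then agent \<open>k\<close> does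
  not envy agent \<open>k - 1\<close>, whichever of them the latter ends up with, and agent \<open>k - 1\<close> does not envy
  agent \<open>k\<close>. The procedure is repeated on the trimmings, which agent \<open>k\<close> sees shrink by a factor
  \<open>k/(k + 1)\<close> each time. Since agent \<open>k - 1\<close> is indifferent between its trimmed bundles, they may be
  matched across rounds so that each accumulated bundle contains the most trimmed one of some early
  round. After \<open>O(k log k)\<close> rounds agent \<open>k\<close> therefore prefers its own share to any accumulated bundle
  even if all remaining trimmings are added, and these can be set aside for the agents below \<open>k\<close>.
  Iterating over all \<open>k\<close> takes \<open>\<Prod>k. O(k log k) = n^((1+o(1))n)\<close> rounds, after which the cakes set aside
  are divided recursively, each along a shorter line.\<close>

text \<open>A protocol is handled through the set of profiles compatible with the answers so far. The values
  of all agents on all current intervals are kept known, so that each cut costs only \<open>n + 1\<close> queries,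
  however fragmented the cake is.\<close>

type_synonym cake = "(real \<times> real) multiset"
type_synonym profile = "nat \<Rightarrow> real \<Rightarrow> real \<Rightarrow> real"

section \<open>Subdivisions of cakes\<close>

definition inside_unit :: "cake \<Rightarrow> bool" where
  "inside_unit M \<longleftrightarrow> (\<forall>p\<in>#M. 0 \<le> fst p \<and> fst p \<le> snd p \<and> snd p \<le> 1)"

definition cake_value :: "(real \<Rightarrow> real \<Rightarrow> real) \<Rightarrow> cake \<Rightarrow> real" where
  "cake_value v M = (\<Sum>(a,b)\<in>#M. v a b)"

text \<open>Cutting at a point is the only operation ever applied to a cake; handing over, pooling
  and setting aside merely regroup a multiset sum. Cuts at endpoints are allowed, so degenerate
  intervals need no special treatment.\<close>

inductive subdivides :: "cake \<Rightarrow> cake \<Rightarrow> bool" where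
  refl: "subdivides M M"
| split: "subdivides M (add_mset (a,b) K) \<Longrightarrow> a \<le> z \<Longrightarrow> z \<le> b \<Longrightarrow>
    subdivides M (add_mset (a,z) (add_mset (z,b) K))"

lemma subdivides_trans:
  assumes "subdivides L M" "subdivides M N"
  shows "subdivides L N"
  using assms(2,1)
proof (induction M N rule: subdivides.induct)
  case (split M a b K z)
  then show ?case using subdivides.split[of L a b K z] by simp
qed simp

lemma subdivides_add_right: "subdivides M N \<Longrightarrow> subdivides (M + K) (N + K)"
proof (induction M N rule: subdivides.induct)
  case (split M a b K' z)
  then show ?case using subdivides.split[of "M + K" a b "K' + K" z] by simp
qed (rule subdivides.refl)

lemma subdivides_add:
  assumes "subdivides M N" "subdivides M' N'"
  shows "subdivides (M + M') (N + N')"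
  using subdivides_trans[OF subdivides_add_right[OF assms(1), of M']
      subdivides_add_right[OF assms(2), of N, unfolded add.commute[of _ N]]] .

lemma subdivides_sum:
  "(\<And>b. b \<in> S \<Longrightarrow> subdivides (f b) (g b)) \<Longrightarrow> subdivides (sum f S) (sum g S)"
proof (induction S rule: infinite_finite_induct)
  case (insert b S)
  then show ?case using subdivides_add[of "f b" "g b" "sum f S" "sum g S"] by simp
qed (simp_all add: subdivides.refl)

lemma inside_unit_add [simp]: "inside_unit (M + N) \<longleftrightarrow> inside_unit M \<and> inside_unit N"
  by (auto simp: inside_unit_def)

lemma inside_unit_add_mset [simp]:
  "inside_unit (add_mset (a,b) M) \<longleftrightarrow> 0 \<le> a \<and> a \<le> b \<and> b \<le> 1 \<and> inside_unit M"
  by (simp add: inside_unit_def)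

lemma cake_value_empty [simp]: "cake_value v {#} = 0"
  by (simp add: cake_value_def)

lemma cake_value_add_mset [simp]: "cake_value v (add_mset (a,b) M) = v a b + cake_value v M"
  by (simp add: cake_value_def)

lemma cake_value_add [simp]: "cake_value v (M + N) = cake_value v M + cake_value v N"
  by (simp add: cake_value_def)

lemma cake_value_sum [simp]: "cake_value v (sum f S) = (\<Sum>b\<in>S. cake_value v (f b))"
  by (induction S rule: infinite_finite_induct) auto

lemma valuation_nonneg:
  assumes "valuation v" "0 \<le> x" "x \<le> y" "y \<le> 1"
  shows "0 \<le> v x y"
  using conjunct1[OF assms(1)[unfolded valuation_def]] assms(2-4) by blast

lemma valuation_additive:
  assumes "valuation v" "0 \<le> x" "x \<le> y" "y \<le> z" "z \<le> 1"
  shows "v x z = v x y + v y z"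
  by (rule conjunct1[OF conjunct2[OF assms(1)[unfolded valuation_def]], rule_format, OF assms(2-5)])

text \<open>The cut axiom takes a fraction \<open>l\<close> of an interval; the absolute target
  \<open>t\<close> is turned into such a fraction, which also keeps the cut point inside
  \<open>[x,b]\<close>.\<close>

lemma valuation_cut:
  assumes "valuation v" "0 \<le> x" "x \<le> b" "b \<le> 1" "0 \<le> t" "t \<le> v x b"
  shows "\<exists>y. x \<le> y \<and> y \<le> b \<and> v x y = t"
proof -
  \<comment> \<open>If \<open>v x b = 0\<close> then \<open>t = 0\<close>, and the quotient is 0 by
    the convention on division.\<close>
  have "0 \<le> t / v x b" "t / v x b \<le> 1"
    using assms(5,6) by (auto simp: divide_simps)
  then have "\<exists>y. x \<le> y \<and> y \<le> b \<and> v x y = t / v x b * v x b"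
    by (rule conjunct1[OF conjunct2[OF conjunct2[OF assms(1)[unfolded valuation_def]]],
          rule_format, OF assms(2-4)])
  moreover have "t / v x b * v x b = t"
    using assms(5,6) by (cases "v x b = 0") auto
  ultimately show ?thesis by simp
qed

lemma cake_value_nonneg: "valuation v \<Longrightarrow> inside_unit M \<Longrightarrow> 0 \<le> cake_value v M"
proof (induction M)
  case (add p M)
  obtain a b where "p = (a,b)" by fastforce
  with add valuation_nonneg[of v a b] show ?case by simp
qed simp

lemma subdivides_inside_unit: "subdivides M N \<Longrightarrow> inside_unit M \<Longrightarrow> inside_unit N"
  by (induction M N rule: subdivides.induct) auto

lemma subdivides_cake_value:
  assumes "subdivides M N" "inside_unit M" "valuation v"
  shows "cake_value v N = cake_value v M"
  using assms
proof (induction M N rule: subdivides.induct)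
  case (split M a b K z)
  have "inside_unit (add_mset (a,b) K)"
    using subdivides_inside_unit[OF split.hyps(1) split.prems(1)] .
  then have "v a b = v a z + v z b"
    using split.hyps split.prems by (intro valuation_additive) simp_all
  with split show ?case by simp
qed simp

text \<open>Pairs are submultisets, so an interval is compared with a second copy of itself but not
  with itself. This mirrors the comparison of distinct positions in
  \<open>is_allocation\<close>.\<close>

definition non_overlapping :: "cake \<Rightarrow> bool" where
  "non_overlapping M \<longleftrightarrow>
    (\<forall>p q. {#p, q#} \<subseteq># M \<longrightarrow> snd p \<le> fst q \<or> snd q \<le> fst p)"

lemma pair_subseteq_iff: "{#p, q#} \<subseteq># M \<longleftrightarrow> p \<in># M \<and> q \<in># M - {#p#}"
  by (simp add: insert_subset_eq_iff)

lemma non_overlapping_add_mset: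
  "non_overlapping (add_mset x M) \<longleftrightarrow>
    non_overlapping M \<and> (\<forall>q\<in>#M. snd x \<le> fst q \<or> snd q \<le> fst x)"
proof -
  have "{#p, q#} \<subseteq># add_mset x M \<longleftrightarrow>
    (p = x \<and> q \<in># M) \<or> (q = x \<and> p \<in># M) \<or> {#p, q#} \<subseteq># M" for p q
    unfolding pair_subseteq_iff by (cases "p = x") (auto dest: in_diffD)
  then show ?thesis
    unfolding non_overlapping_def by (metis (no_types, lifting))
qed

lemma subdivides_non_overlapping:
  "subdivides M N \<Longrightarrow> inside_unit M \<Longrightarrow> non_overlapping M \<Longrightarrow> non_overlapping N"
proof (induction M N rule: subdivides.induct)
  case (split M a b K z)
  then show ?case
    by (simp add: non_overlapping_add_mset) (meson order_trans)
qed simp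

lemma subdivides_Union:
  "subdivides M N \<Longrightarrow> inside_unit M \<Longrightarrow> (\<Union>(a,b)\<in>set_mset N. {a..b}) = (\<Union>(a,b)\<in>set_mset M. {a..b})"
proof (induction M N rule: subdivides.induct)
  case (split M a b K z)
  have "{a..b} = {a..z} \<union> {z..b}"
    using split by auto
  with split show ?case by auto
qed simp

section \<open>Knowledge\<close>

definition profiles :: "nat \<Rightarrow> profile set" where
  "profiles N = {v. \<forall>i<N. valuation (v i)}"

text \<open>A value is known when all profiles in \<open>V\<close> agree on it. A choice computed
  from one such profile is therefore a legitimate choice of the protocol.\<close>

definition informed :: "nat \<Rightarrow> profile set \<Rightarrow> cake \<Rightarrow> bool" where
  "informed N V M \<longleftrightarrow> inside_unit M \<and>
    (\<forall>v\<in>V. \<forall>v'\<in>V. \<forall>i<N. \<forall>p\<in>#M. v i (fst p) (snd p) = v' i (fst p) (snd p))"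

lemma informed_empty [simp]: "informed N V {#}"
  by (simp add: informed_def inside_unit_def)

lemma informed_add [simp]: "informed N V (M + M') \<longleftrightarrow> informed N V M \<and> informed N V M'"
  unfolding informed_def inside_unit_add set_mset_union ball_Un by blast

lemma informed_sum [simp]:
  "finite S \<Longrightarrow> informed N V (sum f S) \<longleftrightarrow> (\<forall>b\<in>S. informed N V (f b))"
  by (induction S rule: finite_induct) auto

lemma informed_mono: "informed N V M \<Longrightarrow> V' \<subseteq> V \<Longrightarrow> informed N V' M"
  unfolding informed_def by blast

lemma informed_cake_value:
  assumes "informed N V M" "v \<in> V" "v' \<in> V" "i < N"
  shows "cake_value (v i) M = cake_value (v' i) M"
  unfolding cake_value_def
  using assms unfolding informed_def case_prod_unfold
  by (intro arg_cong[where f = sum_mset] image_mset_cong) blast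

lemma informed_cake_value_nonneg:
  "informed N V M \<Longrightarrow> V \<subseteq> profiles N \<Longrightarrow> v \<in> V \<Longrightarrow> i < N \<Longrightarrow> 0 \<le> cake_value (v i) M"
  by (intro cake_value_nonneg) (auto simp: informed_def profiles_def)

lemma informed_subdivides_cake_value:
  "informed N V M \<Longrightarrow> subdivides M M' \<Longrightarrow> V \<subseteq> profiles N \<Longrightarrow> v \<in> V \<Longrightarrow> i < N \<Longrightarrow>
    cake_value (v i) M' = cake_value (v i) M"
  by (intro subdivides_cake_value) (auto simp: informed_def profiles_def)

section \<open>Query strategies and their composition\<close>

text \<open>A game against the oracle in which \<open>V\<close> shrinks to the profiles compatible
  with each answer. A cut must cope with every point \<open>y\<close>, even one that no profile in
  \<open>V\<close> admits; \<open>impossible\<close> discharges the empty set left in that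
  case.\<close>

inductive reaches :: "nat \<Rightarrow> (profile set \<Rightarrow> bool) \<Rightarrow> nat \<Rightarrow> profile set \<Rightarrow> bool"
  for N Q where
  now: "Q V \<Longrightarrow> reaches N Q k V"
| impossible: "reaches N Q k {}"
| cut: "\<lbrakk>i < N; 0 \<le> x; x \<le> 1; \<forall>v\<in>V. \<exists>y. x \<le> y \<and> y \<le> 1 \<and> v i x y = t;
     \<forall>y. x \<le> y \<and> y \<le> 1 \<longrightarrow> reaches N Q k {v\<in>V. v i x y = t}\<rbrakk> \<Longrightarrow> reaches N Q (Suc k) V"
| eval: "\<lbrakk>i < N; 0 \<le> x; x \<le> y; y \<le> 1; \<forall>c. reaches N Q k {v\<in>V. v i x y = c}\<rbrakk> \<Longrightarrow>
     reaches N Q (Suc k) V"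

lemma reaches_mono: "reaches N Q k V \<Longrightarrow> k \<le> k' \<Longrightarrow> reaches N Q k' V"
proof (induction arbitrary: k' rule: reaches.induct)
  case (cut i x V t k)
  from cut.prems obtain l where "k' = Suc l" "k \<le> l"
    by (metis Suc_le_D Suc_le_mono)
  with cut show ?case by (auto intro!: reaches.cut[where i = i and x = x and t = t])
next
  case (eval i x y k V)
  from eval.prems obtain l where "k' = Suc l" "k \<le> l"
    by (metis Suc_le_D Suc_le_mono)
  with eval show ?case by (auto intro!: reaches.eval[where i = i and x = x and y = y])
qed (auto intro: reaches.intros)

text \<open>Sequential composition: the second strategy is grafted onto every leaf of the first, and
  the query counts add up. Empty leaves need no continuation, so a continuation may pick a witness
  profile from \<open>V'\<close>.\<close>

lemma reaches_bind:
  assumes "reaches N Q k V"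
    and "\<And>V'. Q V' \<Longrightarrow> V' \<subseteq> V \<Longrightarrow> V' \<noteq> {} \<Longrightarrow> reaches N Q' l V'"
  shows "reaches N Q' (k + l) V"
  using assms
proof (induction rule: reaches.induct)
  case (now V k)
  then show ?case
    by (cases "V = {}") (simp_all add: reaches.impossible reaches_mono[where k = l])
next
  case (cut i x V t k)
  have "reaches N Q' (k + l) {v\<in>V. v i x y = t}" if "x \<le> y" "y \<le> 1" for y
  proof -
    have "reaches N Q' l V'" if "Q V'" "V' \<subseteq> {v\<in>V. v i x y = t}" "V' \<noteq> {}" for V'
      using cut.prems that by blast
    with cut.IH that show ?thesis by blast
  qed
  then show ?case
    using cut.hyps by (auto intro!: reaches.cut[where i = i and x = x and t = t])
next
  case (eval i x y k V)
  have "reaches N Q' (k + l) {v\<in>V. v i x y = c}" for c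
  proof -
    have "reaches N Q' l V'" if "Q V'" "V' \<subseteq> {v\<in>V. v i x y = c}" "V' \<noteq> {}" for V'
      using eval.prems that by blast
    with eval.IH show ?thesis by blast
  qed
  then show ?case
    using eval.hyps by (auto intro!: reaches.eval[where i = i and x = x and y = y])
qed (auto intro: reaches.impossible)

lemma reaches_weaken:
  assumes "reaches N Q k V"
    and "\<And>V'. Q V' \<Longrightarrow> V' \<subseteq> V \<Longrightarrow> V' \<noteq> {} \<Longrightarrow> Q' V'"
  shows "reaches N Q' k V"
  using reaches_bind[of N Q k V Q' 0] assms by (auto intro: reaches.now)

text \<open>Choosing one subtree per answer gives the continuation function of the decision tree.
  The resulting protocol is fixed before the profile \<open>v\<close>.\<close>

lemma reaches_protocol:
  assumes "reaches N (\<lambda>V'. \<exists>A. \<forall>v\<in>V'. line_local_envy_free N v A) k V"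
  shows "\<exists>P. \<forall>v\<in>V. rw_correct N v P k"
  using assms
proof (induction rule: reaches.induct)
  case (now V k)
  then obtain A where "\<forall>v\<in>V. line_local_envy_free N v A" by blast
  then show ?case by (intro exI[of _ "Output A"]) (auto intro: rw_correct.out)
next
  case (cut i x V t k)
  \<comment> \<open>Points outside \<open>[x,1]\<close> are never answers, so any subtree will do
    there.\<close>
  have "\<exists>P. x \<le> y \<and> y \<le> 1 \<longrightarrow> (\<forall>v\<in>{v\<in>V. v i x y = t}. rw_correct N v P k)" for y
  proof (cases "x \<le> y \<and> y \<le> 1")
    case True
    with cut.IH obtain P where "\<forall>v\<in>{v\<in>V. v i x y = t}. rw_correct N v P k" by presburger
    then show ?thesis by (intro exI[of _ P]) simp
  next
    case False
    show ?thesis by (rule exI, rule impI, rule FalseE) (use False in simp)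
  qed
  then obtain f where f: "\<forall>y. x \<le> y \<and> y \<le> 1 \<longrightarrow>
      (\<forall>v\<in>{v\<in>V. v i x y = t}. rw_correct N v (f y) k)"
    by (rule exE[OF choice[OF allI]]) (rule that)
  have "rw_correct N v (Cut i x t f) (Suc k)" if "v \<in> V" for v
    using cut.hyps that f by (intro rw_correct.cut) simp_all
  then show ?case by blast
next
  case (eval i x y k V)
  then have "\<exists>P. \<forall>v\<in>{v\<in>V. v i x y = c}. rw_correct N v P k" for c
    by simp
  then obtain f where f: "\<forall>c. \<forall>v\<in>{v\<in>V. v i x y = c}. rw_correct N v (f c) k"
    by (rule exE[OF choice[OF allI]]) (rule that)
  have "rw_correct N v (Eval i x y f) (Suc k)" if "v \<in> V" for v
    using eval.hyps that f by (intro rw_correct.eval) simp_all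
  then show ?case by blast
qed simp

section \<open>Splitting cakes\<close>

lemma reaches_eval_all:
  assumes "0 \<le> x" "x \<le> y" "y \<le> 1" "m \<le> N"
  shows "reaches N (\<lambda>V'. \<forall>v\<in>V'. \<forall>v'\<in>V'. \<forall>i<m. v i x y = v' i x y) m V"
  using assms(4)
proof (induction m)
  case 0
  show ?case by (auto intro: reaches.now)
next
  case (Suc m)
  have "reaches N (\<lambda>V'. \<forall>v\<in>V'. \<forall>v'\<in>V'. \<forall>i<Suc m. v i x y = v' i x y) (m + 1) V"
  proof (rule reaches_bind[OF Suc.IH])
    fix V' :: "profile set" assume *: "\<forall>v\<in>V'. \<forall>v'\<in>V'. \<forall>i<m. v i x y = v' i x y"
    have "reaches N (\<lambda>V'. \<forall>v\<in>V'. \<forall>v'\<in>V'. \<forall>i<Suc m. v i x y = v' i x y) 0 {v\<in>V'. v m x y = c}"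
      for c using * by (intro reaches.now) (auto simp: less_Suc_eq)
    then show "reaches N (\<lambda>V'. \<forall>v\<in>V'. \<forall>v'\<in>V'. \<forall>i<Suc m. v i x y = v' i x y) 1 V'"
      using assms Suc.prems by (auto intro!: reaches.eval[where i = m and x = x and y = y])
  qed (use Suc.prems in simp)
  then show ?case by simp
qed

text \<open>One cut by agent \<open>i\<close>, then one evaluation of the left part per agent. The
  values of the right part follow by additivity.\<close>

lemma reaches_split_interval:
  assumes "V \<subseteq> profiles N" "informed N V {#(a,b)#}" "i < N" "0 \<le> t" "\<forall>v\<in>V. t \<le> v i a b"
  shows "reaches N (\<lambda>V'. \<exists>z. a \<le> z \<and> z \<le> b \<and> informed N V' {#(a,z), (z,b)#} \<and>
    (\<forall>v\<in>V'. v i a z = t)) (Suc N) V"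
proof -
  let ?Q = "\<lambda>V'. \<exists>z. a \<le> z \<and> z \<le> b \<and> informed N V' {#(a,z), (z,b)#} \<and> (\<forall>v\<in>V'. v i a z = t)"
  have ab: "0 \<le> a" "a \<le> b" "b \<le> 1"
    using assms(2) by (auto simp: informed_def inside_unit_def)
  have val: "valuation (v j)" if "v \<in> V" "j < N" for v j
    using assms(1) that by (auto simp: profiles_def)
  have "reaches N ?Q N {v\<in>V. v i a y = t}" if y: "a \<le> y" "y \<le> 1" for y
  proof -
    define z where "z = min y b"
    have z: "a \<le> z" "z \<le> b" "0 \<le> z" "z \<le> 1"
      using y ab by (auto simp: z_def)
    \<comment> \<open>The oracle may answer beyond the interval when its remainder is worthless to the agent.\<close>
    have at: "v i a z = t" if "v \<in> V" "v i a y = t" for v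
    proof (cases "y \<le> b")
      case False
      then have "v i a y = v i a b + v i b y" "0 \<le> v i b y"
        using y ab valuation_additive[OF val[OF that(1) assms(3)], of a b y]
          valuation_nonneg[OF val[OF that(1) assms(3)], of b y] by auto
      with False assms(5) that show ?thesis by (fastforce simp: z_def)
    qed (use that in \<open>simp add: z_def\<close>)
    show ?thesis
    proof (rule reaches_weaken[OF reaches_eval_all[of a z N]])
      fix V' assume V': "\<forall>v\<in>V'. \<forall>v'\<in>V'. \<forall>i<N. v i a z = v' i a z"
        "V' \<subseteq> {v\<in>V. v i a y = t}"
      have "v j z b = v' j z b" if "v \<in> V'" "v' \<in> V'" "j < N" for v v' j
      proof -
        have "v j a b = v j a z + v j z b" "v' j a b = v' j a z + v' j z b"
          using V'(2) that z ab by (auto intro!: valuation_additive val)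
        moreover have "v j a b = v' j a b"
          using assms(2) V'(2) that unfolding informed_def by auto
        ultimately show ?thesis using V'(1) that by fastforce
      qed
      then have "informed N V' {#(a,z), (z,b)#}"
        using V'(1) z ab unfolding informed_def inside_unit_def by auto
      with at V'(2) z show "?Q V'" by blast
    qed (use z ab in auto)
  qed
  moreover have "\<forall>v\<in>V. \<exists>y. a \<le> y \<and> y \<le> 1 \<and> v i a y = t"
    using valuation_cut ab assms(3-5) val by (meson order_trans)
  ultimately show ?thesis
    using ab assms(3) by (intro reaches.cut[where i = i and x = a and t = t]) auto
qed

text \<open>Intervals are taken whole until the target falls inside one, and only that one is cut.
  Locating it is free because the values are known, so the cost does not depend on the number of
  intervals.\<close>

lemma reaches_split_cake:
  assumes "V \<subseteq> profiles N" "informed N V M" "i < N" "0 \<le> t" "\<forall>v\<in>V. t \<le> cake_value (v i) M"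
  shows "reaches N (\<lambda>V'. \<exists>P R. subdivides M (P + R) \<and> informed N V' (P + R) \<and>
    (\<forall>v\<in>V'. cake_value (v i) P = t)) (Suc N) V"
  using assms
proof (induction M arbitrary: t)
  case empty
  then show ?case
    by (intro reaches.now exI[of _ "{#}"]) (auto intro: subdivides.refl)
next
  case (add p M)
  obtain a b where p: "p = (a,b)" by fastforce
  have inf: "informed N V {#(a,b)#}" "informed N V M"
    using add.prems(2) informed_add[of N V "{#p#}" M] by (auto simp: p)
  show ?case
  proof (cases "\<forall>v\<in>V. t \<le> v i a b")
    case True
    show ?thesis
    proof (rule reaches_weaken[OF reaches_split_interval[OF add.prems(1) inf(1) add.prems(3,4) True]])
      fix V' assume "\<exists>z. a \<le> z \<and> z \<le> b \<and> informed N V' {#(a,z), (z,b)#} \<and> (\<forall>v\<in>V'. v i a z = t)"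
        and V': "V' \<subseteq> V"
      then obtain z where z: "a \<le> z" "z \<le> b" "informed N V' {#(a,z), (z,b)#}"
        "\<forall>v\<in>V'. v i a z = t" by blast
      have "informed N V' ({#(a,z), (z,b)#} + M)"
        using z(3) inf(2) V' informed_add informed_mono by blast
      then show "\<exists>P R. subdivides (add_mset p M) (P + R) \<and> informed N V' (P + R) \<and>
        (\<forall>v\<in>V'. cake_value (v i) P = t)"
        using z subdivides.split[OF subdivides.refl, where a = a and b = b and K = M and z = z]
        by - (rule exI[of _ "{#(a,z)#}"], rule exI[of _ "add_mset (z,b) M"],
            simp add: p add_mset_commute)
    qed
  next
    case False
    \<comment> \<open>A single profile below the target suffices: the value is the same throughout
      \<open>V\<close>, so the whole interval goes into \<open>P\<close>.\<close>
    then obtain w where w: "w \<in> V" "w i a b < t" by force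
    have known: "v i a b = w i a b" if "v \<in> V" for v
      using inf(1) w(1) that add.prems(3) unfolding informed_def by auto
    show ?thesis
    proof (rule reaches_weaken[OF add.IH[of "t - w i a b"]])
      show "\<forall>v\<in>V. t - w i a b \<le> cake_value (v i) M"
        using add.prems(5) known by (auto simp: p algebra_simps)
      fix V' assume "\<exists>P R. subdivides M (P + R) \<and> informed N V' (P + R) \<and>
        (\<forall>v\<in>V'. cake_value (v i) P = t - w i a b)" and V': "V' \<subseteq> V"
      then obtain P R where PR: "subdivides M (P + R)" "informed N V' (P + R)"
        "\<forall>v\<in>V'. cake_value (v i) P = t - w i a b" by blast
      have "informed N V' ({#(a,b)#} + (P + R))"
        using PR(2) inf(1) V' informed_add informed_mono by blast
      moreover have "subdivides ({#(a,b)#} + M) ({#(a,b)#} + (P + R))"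
        using PR(1) by (intro subdivides_add subdivides.refl)
      moreover have "v i a b = w i a b" if "v \<in> V'" for v
        using known V' that by blast
      ultimately show "\<exists>P R. subdivides (add_mset p M) (P + R) \<and> informed N V' (P + R) \<and>
        (\<forall>v\<in>V'. cake_value (v i) P = t)"
        using PR(3)
        by - (rule exI[of _ "add_mset (a,b) P"], rule exI[of _ R], auto simp: p)
    qed (use w add.prems inf in auto)
  qed
qed

lemma reaches_carve:
  assumes "V \<subseteq> profiles N" "informed N V M" "i < N" "0 \<le> t"
    "\<forall>v\<in>V. real m * t \<le> cake_value (v i) M"
  shows "reaches N (\<lambda>V'. \<exists>B R. subdivides M ((\<Sum>b<m. B b) + R) \<and>
    informed N V' ((\<Sum>b<m. B b) + R) \<and> (\<forall>v\<in>V'. \<forall>b<m. cake_value (v i) (B b) = t))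
    (m * Suc N) V"
  using assms(5)
proof (induction m)
  case 0
  then show ?case
    using assms(2) by (intro reaches.now exI[of _ "\<lambda>_. {#}"] exI[of _ M]) (auto intro: subdivides.refl)
next
  case (Suc m)
  let ?Q = "\<lambda>m V'. \<exists>B R. subdivides M ((\<Sum>b<m. B b) + R) \<and>
    informed N V' ((\<Sum>b<m. B b) + R) \<and> (\<forall>v\<in>V'. \<forall>b<m. cake_value (v i) (B b) = t)"
  have "reaches N (?Q (Suc m)) (m * Suc N + Suc N) V"
  proof (rule reaches_bind[of N "?Q m"])
    show "reaches N (?Q m) (m * Suc N) V"
      using Suc.prems assms(4) by (intro Suc.IH) (auto simp: algebra_simps)
    fix V' assume "?Q m V'" and V': "V' \<subseteq> V"
    then obtain B R where BR: "subdivides M ((\<Sum>b<m. B b) + R)"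
      "informed N V' ((\<Sum>b<m. B b) + R)" "\<forall>v\<in>V'. \<forall>b<m. cake_value (v i) (B b) = t"
      by blast
    have "t \<le> cake_value (v i) R" if "v \<in> V'" for v
    proof -
      have "cake_value (v i) ((\<Sum>b<m. B b) + R) = cake_value (v i) M"
        using BR(1) assms(1-3) V' that by (intro informed_subdivides_cake_value[of N V]) auto
      then have "cake_value (v i) R = cake_value (v i) M - m * t"
        using BR(3) that by simp
      with Suc.prems V' that show ?thesis by (force simp: algebra_simps)
    qed
    then have "reaches N (\<lambda>V''. \<exists>P R'. subdivides R (P + R') \<and> informed N V'' (P + R') \<and>
        (\<forall>v\<in>V''. cake_value (v i) P = t)) (Suc N) V'"
      using assms V' BR(2) by (intro reaches_split_cake) auto
    then show "reaches N (?Q (Suc m)) (Suc N) V'"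
    proof (rule reaches_weaken)
      fix V'' assume "\<exists>P R'. subdivides R (P + R') \<and> informed N V'' (P + R') \<and>
        (\<forall>v\<in>V''. cake_value (v i) P = t)" and V'': "V'' \<subseteq> V'"
      then obtain P R' where PR: "subdivides R (P + R')" "informed N V'' (P + R')"
        "\<forall>v\<in>V''. cake_value (v i) P = t" by blast
      define B' where "B' = B(m := P)"
      have sum: "(\<Sum>b<Suc m. B' b) = (\<Sum>b<m. B b) + P"
        by (simp add: B'_def)
      have "subdivides M ((\<Sum>b<Suc m. B' b) + R')"
        unfolding sum using subdivides_trans[OF BR(1)] subdivides_add[OF subdivides.refl PR(1)]
        by (simp add: add.assoc)
      moreover have "informed N V'' ((\<Sum>b<Suc m. B' b) + R')"
        unfolding sum using BR(2) PR(2) V'' informed_mono by (auto simp del: informed_sum)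
      moreover have "\<forall>v\<in>V''. \<forall>b<Suc m. cake_value (v i) (B' b) = t"
        using PR(3) BR(3) V'' by (auto simp: B'_def less_Suc_eq)
      ultimately show "?Q (Suc m) V''" by blast
    qed
  qed
  then show ?case by (simp only: mult_Suc add.commute[of "Suc N"])
qed

text \<open>Agent \<open>i\<close> carves off \<open>k - 1\<close> pieces worth a
  \<open>k\<close>-th of its known total; the remainder is then worth a \<open>k\<close>-th too and
  is the last bundle.\<close>

lemma reaches_equal_division:
  assumes "V \<subseteq> profiles N" "informed N V M" "i < N" "0 < k"
  shows "reaches N (\<lambda>V'. \<exists>B. subdivides M (\<Sum>b<k. B b) \<and> informed N V' (\<Sum>b<k. B b) \<and>
    (\<forall>v\<in>V'. \<forall>b<k. \<forall>b'<k. cake_value (v i) (B b) = cake_value (v i) (B b'))) (k * Suc N) V"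
proof (cases "V = {}")
  case False
  then obtain w where w: "w \<in> V" by blast
  obtain m where k: "k = Suc m" using assms(4) gr0_implies_Suc by blast
  define t where "t = cake_value (w i) M / k"
  have t: "0 \<le> t"
    using informed_cake_value_nonneg[OF assms(2,1) w assms(3)] by (simp add: t_def)
  have val: "cake_value (v i) M = (m + 1) * t" if "v \<in> V" for v
    using informed_cake_value[OF assms(2) that w assms(3)] by (simp add: t_def k)
  have "reaches N (\<lambda>V'. \<exists>B R. subdivides M ((\<Sum>b<m. B b) + R) \<and>
    informed N V' ((\<Sum>b<m. B b) + R) \<and> (\<forall>v\<in>V'. \<forall>b<m. cake_value (v i) (B b) = t))
    (m * Suc N) V"
    using assms t by (intro reaches_carve) (auto simp: val algebra_simps)
  then have "reaches N (\<lambda>V'. \<exists>B. subdivides M (\<Sum>b<k. B b) \<and> informed N V' (\<Sum>b<k. B b) \<and>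
    (\<forall>v\<in>V'. \<forall>b<k. \<forall>b'<k. cake_value (v i) (B b) = cake_value (v i) (B b'))) (m * Suc N) V"
  proof (rule reaches_weaken)
    fix V' assume "\<exists>B R. subdivides M ((\<Sum>b<m. B b) + R) \<and>
      informed N V' ((\<Sum>b<m. B b) + R) \<and> (\<forall>v\<in>V'. \<forall>b<m. cake_value (v i) (B b) = t)"
      and V': "V' \<subseteq> V"
    then obtain B R where BR: "subdivides M ((\<Sum>b<m. B b) + R)"
      "informed N V' ((\<Sum>b<m. B b) + R)" "\<forall>v\<in>V'. \<forall>b<m. cake_value (v i) (B b) = t"
      by blast
    define B' where "B' = B(m := R)"
    have sum: "(\<Sum>b<k. B' b) = (\<Sum>b<m. B b) + R"
      by (simp add: B'_def k)
    have "cake_value (v i) (B' b) = t" if "v \<in> V'" "b < k" for v b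
    proof -
      have "cake_value (v i) ((\<Sum>b<m. B b) + R) = cake_value (v i) M"
        using BR(1) assms(1-3) V' that by (intro informed_subdivides_cake_value[of N V]) auto
      then have "cake_value (v i) R = t"
        using BR(3) that val[of v] V' by (auto simp: algebra_simps)
      then show ?thesis
        using BR(3) that by (auto simp: B'_def k less_Suc_eq)
    qed
    then show "\<exists>B. subdivides M (\<Sum>b<k. B b) \<and> informed N V' (\<Sum>b<k. B b) \<and>
      (\<forall>v\<in>V'. \<forall>b<k. \<forall>b'<k. cake_value (v i) (B b) = cake_value (v i) (B b'))"
      using BR(1,2) by (intro exI[of _ B']) (simp add: sum)
  qed
  then show ?thesis by (rule reaches_mono) (simp add: k)
qed (simp add: reaches.impossible)

text \<open>Each bundle is trimmed separately, so that every trimming \<open>R b\<close> remains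
  attached to the bundle it came from.\<close>

lemma reaches_trim:
  assumes "V \<subseteq> profiles N" "i < N" "0 \<le> t" "\<And>b. b < k \<Longrightarrow> informed N V (C b)"
    "\<And>b v. b < k \<Longrightarrow> v \<in> V \<Longrightarrow> t \<le> cake_value (v i) (C b)"
  shows "reaches N (\<lambda>V'. \<exists>P R. \<forall>b<k. subdivides (C b) (P b + R b) \<and>
    informed N V' (P b + R b) \<and> (\<forall>v\<in>V'. cake_value (v i) (P b) = t)) (k * Suc N) V"
  using assms(4,5)
proof (induction k)
  case 0
  then show ?case by (auto intro: reaches.now)
next
  case (Suc k)
  let ?Q = "\<lambda>k V'. \<exists>P R. \<forall>b<k. subdivides (C b) (P b + R b) \<and>
    informed N V' (P b + R b) \<and> (\<forall>v\<in>V'. cake_value (v i) (P b) = t)"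
  have "reaches N (?Q (Suc k)) (k * Suc N + Suc N) V"
  proof (rule reaches_bind[of N "?Q k"])
    show "reaches N (?Q k) (k * Suc N) V"
      using Suc.prems by (intro Suc.IH) auto
    fix V' assume "?Q k V'" and V': "V' \<subseteq> V"
    then obtain P R where PR: "\<forall>b<k. subdivides (C b) (P b + R b) \<and>
      informed N V' (P b + R b) \<and> (\<forall>v\<in>V'. cake_value (v i) (P b) = t)" by blast
    have "reaches N (\<lambda>V''. \<exists>P R. subdivides (C k) (P + R) \<and> informed N V'' (P + R) \<and>
        (\<forall>v\<in>V''. cake_value (v i) P = t)) (Suc N) V'"
      using assms(1-3) V' Suc.prems
      by (intro reaches_split_cake) (auto intro: informed_mono)
    then show "reaches N (?Q (Suc k)) (Suc N) V'"
    proof (rule reaches_weaken)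
      fix V'' assume "\<exists>P R. subdivides (C k) (P + R) \<and> informed N V'' (P + R) \<and>
        (\<forall>v\<in>V''. cake_value (v i) P = t)" and V'': "V'' \<subseteq> V'"
      then obtain P0 R0 where PR0: "subdivides (C k) (P0 + R0)" "informed N V'' (P0 + R0)"
        "\<forall>v\<in>V''. cake_value (v i) P0 = t" by blast
      show "?Q (Suc k) V''"
        using PR PR0 V'' informed_mono[OF _ V'']
        by - (rule exI[of _ "P(k := P0)"], rule exI[of _ "R(k := R0)"],
            auto simp: less_Suc_eq simp del: informed_add)
    qed
  qed
  then show ?case by (simp only: mult_Suc add.commute[of "Suc N"])
qed

section \<open>Domination along the line\<close>

text \<open>At stage \<open>k\<close> the agents \<open>0, \<dots>, k - 1\<close> have not been served yet: each of them will get one of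
  the bundles \<open>B 0, \<dots>, B (k - 1)\<close>, while every agent \<open>j \<ge> k\<close> holds \<open>X j\<close>, and \<open>Z j\<close> is set aside for
  the agents below \<open>j\<close>.\<close>

definition stage_pieces ::
  "nat \<Rightarrow> nat \<Rightarrow> (nat \<Rightarrow> cake) \<Rightarrow> (nat \<Rightarrow> cake) \<Rightarrow> (nat \<Rightarrow> cake) \<Rightarrow> cake" where
  "stage_pieces n k B X Z = (\<Sum>b<k. B b) + (\<Sum>j\<in>{k..<n}. X j + Z j)"

text \<open>Agent \<open>k - 1\<close> is the next to be served. The conditions are linear in the
  bundles, so they survive the pooling of rounds. The last one lets agent \<open>Suc j\<close>
  tolerate that all of \<open>Z (Suc j)\<close> goes to agent \<open>j\<close>; \<open>Z k\<close>
  is left to \<open>dominated\<close>.\<close>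

definition balanced ::
  "nat \<Rightarrow> nat \<Rightarrow> profile \<Rightarrow> (nat \<Rightarrow> cake) \<Rightarrow> (nat \<Rightarrow> cake) \<Rightarrow> (nat \<Rightarrow> cake) \<Rightarrow> bool" where
  "balanced n k v B X Z \<longleftrightarrow>
    (\<forall>b<k. \<forall>b'<k. cake_value (v (k-1)) (B b) = cake_value (v (k-1)) (B b')) \<and>
    (k < n \<longrightarrow> (\<forall>b<k. cake_value (v (k-1)) (X k) \<le> cake_value (v (k-1)) (B b) \<and>
                        cake_value (v k) (B b) \<le> cake_value (v k) (X k))) \<and>
    (\<forall>j. k \<le> j \<and> Suc j < n \<longrightarrow>
      cake_value (v j) (X (Suc j)) \<le> cake_value (v j) (X j) \<and>
      cake_value (v (Suc j)) (X j) + cake_value (v (Suc j)) (Z (Suc j)) \<le>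
        cake_value (v (Suc j)) (X (Suc j)))"

definition dominated ::
  "nat \<Rightarrow> nat \<Rightarrow> profile \<Rightarrow> (nat \<Rightarrow> cake) \<Rightarrow> (nat \<Rightarrow> cake) \<Rightarrow> (nat \<Rightarrow> cake) \<Rightarrow> bool" where
  "dominated n k v B X Z \<longleftrightarrow>
    (k < n \<longrightarrow> (\<forall>b<k. cake_value (v k) (B b) + cake_value (v k) (Z k) \<le> cake_value (v k) (X k)))"

text \<open>The slot \<open>P\<close> records how \<open>Z k\<close> is controlled: by one round, by
  several rounds, or by full domination.\<close>

definition stage_result ::
  "nat \<Rightarrow> nat \<Rightarrow> nat \<Rightarrow> cake \<Rightarrow>
    (profile \<Rightarrow> (nat \<Rightarrow> cake) \<Rightarrow> (nat \<Rightarrow> cake) \<Rightarrow> (nat \<Rightarrow> cake) \<Rightarrow> bool) \<Rightarrow> profile set \<Rightarrow> bool" where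
  "stage_result N n k C P V \<longleftrightarrow> (\<exists>B X Z.
    subdivides C (stage_pieces n k B X Z) \<and> informed N V (stage_pieces n k B X Z) \<and>
    (\<forall>v\<in>V. balanced n k v B X Z \<and> P v B X Z))"

lemma informed_stage_pieces [simp]:
  "informed N V (stage_pieces n k B X Z) \<longleftrightarrow>
    (\<forall>b<k. informed N V (B b)) \<and> (\<forall>j. k \<le> j \<and> j < n \<longrightarrow> informed N V (X j) \<and> informed N V (Z j))"
  by (auto simp: stage_pieces_def)

lemma stage_pieces_split_off:
  "k < n \<Longrightarrow> stage_pieces n k B X Z =
    (\<Sum>b<k. B b) + X k + (\<Sum>j\<in>{Suc k..<n}. X j + Z j) + Z k"
  by (simp add: stage_pieces_def sum.atLeast_Suc_lessThan ac_simps)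

lemma balancedD:
  assumes "balanced n k v B X Z"
  shows "b < k \<Longrightarrow> b' < k \<Longrightarrow> cake_value (v (k-1)) (B b) = cake_value (v (k-1)) (B b')"
    and "k < n \<Longrightarrow> b < k \<Longrightarrow> cake_value (v (k-1)) (X k) \<le> cake_value (v (k-1)) (B b)"
    and "k < n \<Longrightarrow> b < k \<Longrightarrow> cake_value (v k) (B b) \<le> cake_value (v k) (X k)"
    and "k \<le> j \<Longrightarrow> Suc j < n \<Longrightarrow> cake_value (v j) (X (Suc j)) \<le> cake_value (v j) (X j)"
    and "k \<le> j \<Longrightarrow> Suc j < n \<Longrightarrow>
      cake_value (v (Suc j)) (X j) + cake_value (v (Suc j)) (Z (Suc j)) \<le>
        cake_value (v (Suc j)) (X (Suc j))"
  using assms unfolding balanced_def by blast+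

text \<open>\<open>Z k\<close> occurs in no condition, so any \<open>Y\<close> may take its place:
  once a round has redivided \<open>Z k\<close>, only the new trimmings stay set aside.\<close>

lemma balanced_add:
  assumes "balanced n k v B X Z" "balanced n k v B' X' Z'"
  shows "balanced n k v (\<lambda>b. B b + B' b) (\<lambda>j. X j + X' j)
    (\<lambda>j. if j = k then Y else Z j + Z' j)"
  unfolding balanced_def
proof (intro conjI allI impI)
  fix b b' assume "b < k" "b' < k"
  then show "cake_value (v (k-1)) (B b + B' b) = cake_value (v (k-1)) (B b' + B' b')"
    using balancedD(1)[OF assms(1), of b b'] balancedD(1)[OF assms(2), of b b'] by simp
next
  fix b assume "k < n" "b < k"
  then show "cake_value (v (k-1)) (X k + X' k) \<le> cake_value (v (k-1)) (B b + B' b)"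
    "cake_value (v k) (B b + B' b) \<le> cake_value (v k) (X k + X' k)"
    using balancedD(2,3)[OF assms(1), of b] balancedD(2,3)[OF assms(2), of b] by simp_all
next
  fix j assume j: "k \<le> j \<and> Suc j < n"
  then show "cake_value (v j) (X (Suc j) + X' (Suc j)) \<le> cake_value (v j) (X j + X' j)"
    using balancedD(4)[OF assms(1), of j] balancedD(4)[OF assms(2), of j] by simp
  show "cake_value (v (Suc j)) (X j + X' j) +
      cake_value (v (Suc j)) (if Suc j = k then Y else Z (Suc j) + Z' (Suc j)) \<le>
      cake_value (v (Suc j)) (X (Suc j) + X' (Suc j))"
    using j balancedD(5)[OF assms(1), of j] balancedD(5)[OF assms(2), of j] by auto
qed

section \<open>One round of trimming\<close>

lemma sum_transpose:
  fixes f :: "nat \<Rightarrow> 'a::comm_monoid_add"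
  assumes "a < k" "b < k"
  shows "(\<Sum>i<k. f (transpose a b i)) = (\<Sum>i<k. f i)"
proof (rule sum.reindex_bij_betw)
  show "bij_betw (transpose a b) {..<k} {..<k}"
    by (rule bij_betw_byWitness[where f' = "transpose a b"])
      (use assms in \<open>auto simp: transpose_def\<close>)
qed

lemma transpose_less: "a < k \<Longrightarrow> b < k \<Longrightarrow> i < k \<Longrightarrow> transpose a b i < (k::nat)"
  by (auto simp: transpose_def)

lemma exists_arg_min_less:
  fixes f :: "nat \<Rightarrow> real"
  assumes "0 < k"
  obtains w where "w < k" "\<And>b. b < k \<Longrightarrow> f w \<le> f b"
proof -
  have "Min (f ` {..<k}) \<in> f ` {..<k}" using assms by (intro Min_in) auto
  then obtain w where "w < k" "f w = Min (f ` {..<k})" by auto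
  then show ?thesis using that by auto
qed

lemma exists_arg_max_less:
  fixes f :: "nat \<Rightarrow> real"
  assumes "0 < k"
  obtains w where "w < k" "\<And>b. b < k \<Longrightarrow> f b \<le> f w"
  using exists_arg_min_less[OF assms, of "\<lambda>b. - f b"] by auto

text \<open>No cake is lost in a round: the worst bundle \<open>w\<close> is swapped to position
  \<open>k\<close>, the others are trimmed at positions below \<open>k\<close>, and
  \<open>transpose r m\<close> relabels the results.\<close>

lemma subdivides_sum_transpose:
  assumes "subdivides M ((\<Sum>b<Suc k. B b) + Y)" "w < Suc k"
    and "\<And>b. b < k \<Longrightarrow> subdivides (B (transpose w k b)) (P b + R b)" "r < k" "m < k"
  shows "subdivides M ((\<Sum>b<k. P (transpose r m b)) + B w + (Y + (\<Sum>b<k. R b)))"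
proof -
  have "(\<Sum>b<Suc k. B b) = (\<Sum>b<Suc k. B (transpose w k b))"
    using sum_transpose[OF assms(2), of k B] by simp
  also have "\<dots> = (\<Sum>b<k. B (transpose w k b)) + B w"
    by simp
  finally have "subdivides M ((\<Sum>b<k. B (transpose w k b)) + (B w + Y))"
    using assms(1) by (simp add: add.assoc)
  moreover have "subdivides (\<Sum>b<k. B (transpose w k b)) (\<Sum>b<k. P b + R b)"
    using assms(3) by (intro subdivides_sum) simp
  ultimately have "subdivides M ((\<Sum>b<k. P b + R b) + (B w + Y))"
    using subdivides_add_right subdivides_trans by blast
  then show ?thesis
    unfolding sum.distrib sum_transpose[OF assms(4,5)] by (simp add: ac_simps)
qed

text \<open>In round \<open>r\<close>, agent \<open>k\<close> offers \<open>k + 1\<close> bundles it values equally; agent \<open>k - 1\<close> returns the worst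
  one to it and trims the others to a common value. The trimming that costs agent \<open>k\<close> most is made
  to hit bundle \<open>r\<close>.\<close>

definition round_gain ::
  "nat \<Rightarrow> nat \<Rightarrow> cake \<Rightarrow> profile \<Rightarrow> (nat \<Rightarrow> cake) \<Rightarrow> (nat \<Rightarrow> cake) \<Rightarrow> (nat \<Rightarrow> cake) \<Rightarrow> bool" where
  "round_gain k r C v B X Z \<longleftrightarrow>
    (r < k \<longrightarrow> cake_value (v k) (Z k) \<le>
      real k * (cake_value (v k) (X k) - cake_value (v k) (B r))) \<and>
    real (Suc k) * cake_value (v k) (Z k) \<le> real k * cake_value (v k) C"

text \<open>Agent \<open>k\<close> values \<open>B w\<close> like every untrimmed bundle, hence at
  least like every trimmed one; to agent \<open>k - 1\<close> it is worth at most \<open>t\<close>.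
  The edge to agent \<open>Suc k\<close> is safe whichever bundle is returned, by balance and
  domination at stage \<open>Suc k\<close>. The trimmings are at most \<open>k\<close> times the
  largest one, and each is at most an untrimmed bundle, itself at most a \<open>k + 1\<close>-st of
  \<open>C\<close> to agent \<open>k\<close>.\<close>

lemma reaches_round:
  assumes V: "V \<subseteq> profiles N" "informed N V C" and k: "0 < k" "k < n" "n \<le> N"
    and stage: "reaches N (stage_result N n (Suc k) C (dominated n (Suc k))) c V"
  shows "reaches N (stage_result N n k C (round_gain k r C)) (c + k * Suc N) V"
proof (rule reaches_bind[OF stage])
  fix V1 assume V1: "V1 \<subseteq> V" "V1 \<noteq> {}"
    and "stage_result N n (Suc k) C (dominated n (Suc k)) V1"
  then obtain B X Z where sub: "subdivides C (stage_pieces n (Suc k) B X Z)"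
    and inf: "informed N V1 (stage_pieces n (Suc k) B X Z)"
    and bal: "\<And>v. v \<in> V1 \<Longrightarrow> balanced n (Suc k) v B X Z"
    and dom: "\<And>v. v \<in> V1 \<Longrightarrow> dominated n (Suc k) v B X Z"
    unfolding stage_result_def by blast
  have infB: "informed N V1 (B b)" if "b \<le> k" for b
    using inf that by simp
  have V1_profiles: "V1 \<subseteq> profiles N"
    using V(1) V1(1) by blast
  have eq: "cake_value (v k) (B b) = cake_value (v k) (B b')" if "v \<in> V1" "b \<le> k" "b' \<le> k" for v b b'
    using balancedD(1)[OF bal[OF that(1)], of b b'] that(2,3) by simp
  \<comment> \<open>All values involved are known, so any remaining profile can guide the choice of
    \<open>w\<close>, \<open>l\<close> and \<open>t\<close>.\<close>
  obtain u where u: "u \<in> V1" using V1(2) by blast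
  obtain w where w: "w < Suc k"
    and w_le: "\<And>b. b < Suc k \<Longrightarrow> cake_value (u (k-1)) (B w) \<le> cake_value (u (k-1)) (B b)"
    using exists_arg_min_less[of "Suc k" "\<lambda>b. cake_value (u (k-1)) (B b)"] by auto
  define D where "D b = B (transpose w k b)" for b
  have idx: "transpose w k b \<le> k" if "b \<le> k" for b
    using transpose_less[of w "Suc k" k b] w that by simp
  obtain l where l: "l < k"
    and l_le: "\<And>b. b < k \<Longrightarrow> cake_value (u (k-1)) (D l) \<le> cake_value (u (k-1)) (D b)"
    using exists_arg_min_less[of k "\<lambda>b. cake_value (u (k-1)) (D b)"] k by auto
  define t where "t = cake_value (u (k-1)) (D l)"
  have known: "cake_value (v (k-1)) (B b) = cake_value (u (k-1)) (B b)" if "v \<in> V1" "b \<le> k" for v b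
    using informed_cake_value[OF infB[OF that(2)] that(1) u] k by simp
  have w_t: "cake_value (v (k-1)) (B w) \<le> t" if "v \<in> V1" for v
    using known[OF that, of w] w w_le[of "transpose w k l"] idx[of l] l by (simp add: t_def D_def)
  have trim: "reaches N (\<lambda>V'. \<exists>P R. \<forall>b<k. subdivides (D b) (P b + R b) \<and>
      informed N V' (P b + R b) \<and> (\<forall>v\<in>V'. cake_value (v (k-1)) (P b) = t)) (k * Suc N) V1"
  proof (rule reaches_trim[OF V1_profiles])
    show "k - 1 < N" using k by simp
    show "0 \<le> t"
      unfolding t_def D_def using u k V1_profiles
      by (intro informed_cake_value_nonneg[of N V1] infB idx) (use l in auto)
    fix b assume b: "b < k"
    show "informed N V1 (D b)" unfolding D_def using b by (intro infB idx) simp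
    fix v assume "v \<in> V1"
    then show "t \<le> cake_value (v (k-1)) (D b)"
      using l_le[OF b] known[of v "transpose w k b"] idx[of b] b by (simp add: t_def D_def)
  qed
  show "reaches N (stage_result N n k C (round_gain k r C)) (k * Suc N) V1"
  proof (rule reaches_weaken[OF trim])
    fix V2 assume V2: "V2 \<subseteq> V1" "V2 \<noteq> {}"
      and "\<exists>P R. \<forall>b<k. subdivides (D b) (P b + R b) \<and>
        informed N V2 (P b + R b) \<and> (\<forall>v\<in>V2. cake_value (v (k-1)) (P b) = t)"
    then obtain P R where "\<forall>b<k. subdivides (D b) (P b + R b) \<and>
      informed N V2 (P b + R b) \<and> (\<forall>v\<in>V2. cake_value (v (k-1)) (P b) = t)"
      by blast
    then have PR: "\<And>b. b < k \<Longrightarrow> subdivides (D b) (P b + R b)"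
      "\<And>b. b < k \<Longrightarrow> informed N V2 (P b)" "\<And>b. b < k \<Longrightarrow> informed N V2 (R b)"
      "\<And>b v. b < k \<Longrightarrow> v \<in> V2 \<Longrightarrow> cake_value (v (k-1)) (P b) = t"
      by simp_all
    obtain u2 where u2: "u2 \<in> V2" using V2(2) by blast
    obtain m where m: "m < k"
      and m_ge: "\<And>b. b < k \<Longrightarrow> cake_value (u2 k) (R b) \<le> cake_value (u2 k) (R m)"
      using exists_arg_max_less[of k "\<lambda>b. cake_value (u2 k) (R b)"] k by auto
    \<comment> \<open>Moving the largest trimming to position \<open>r\<close> is harmless because
      agent \<open>k - 1\<close> values all trimmed bundles at \<open>t\<close>. From round
      \<open>k\<close> on there is no position left to hit, and \<open>transpose m m\<close> is the
      identity.\<close>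
    define r' where "r' = (if r < k then r else m)"
    have r': "r' < k" using m by (simp add: r'_def)
    define B' where "B' b = P (transpose r' m b)" for b
    define X' where "X' = X(k := B w)"
    define Z' where "Z' = Z(k := \<Sum>b<k. R b)"
    have idx': "transpose r' m b < k" if "b < k" for b
      using transpose_less[OF r' m that] .
    have infV2: "informed N V2 M" if "informed N V1 M" for M
      using informed_mono[OF that V2(1)] .
    have B'_val: "cake_value (v (k-1)) (B' b) = t" if "v \<in> V2" "b < k" for v b
      unfolding B'_def using PR(4)[OF idx'[OF that(2)] that(1)] .
    have P_val: "cake_value (v k) (P b) = cake_value (v k) (B w) - cake_value (v k) (R b)"
      "0 \<le> cake_value (v k) (R b)" if "v \<in> V2" "b < k" for v b
    proof -
      have "cake_value (v k) (P b + R b) = cake_value (v k) (D b)"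
        using PR(1)[OF that(2)] k V1_profiles V2(1) that infB idx
        by (intro informed_subdivides_cake_value[of N V1]) (auto simp: D_def)
      also have "\<dots> = cake_value (v k) (B w)"
        unfolding D_def using V2(1) that w idx by (intro eq) auto
      finally show "cake_value (v k) (P b) = cake_value (v k) (B w) - cake_value (v k) (R b)"
        by simp
      show "0 \<le> cake_value (v k) (R b)"
        using PR(3)[OF that(2)] V2 V1_profiles k that
        by (intro informed_cake_value_nonneg[of N V2]) auto
    qed
    have "subdivides C ((\<Sum>b<k. P (transpose r' m b)) + B w +
        ((\<Sum>j\<in>{Suc k..<n}. X j + Z j) + (\<Sum>b<k. R b)))"
      using sub PR(1) w r' m unfolding stage_pieces_def D_def
      by (intro subdivides_sum_transpose)
    then have sub': "subdivides C (stage_pieces n k B' X' Z')"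
      unfolding stage_pieces_split_off[OF k(2)] by (simp add: B'_def X'_def Z'_def add.assoc)
    have inf': "informed N V2 (stage_pieces n k B' X' Z')"
      using PR(2,3) idx' infV2 infB[of w] w inf k
      by (auto simp: B'_def X'_def Z'_def)
    have "balanced n k v B' X' Z' \<and> round_gain k r C v B' X' Z'" if v: "v \<in> V2" for v
    proof
      have v1: "v \<in> V1" using v V2(1) by blast
      show "balanced n k v B' X' Z'"
        unfolding balanced_def
      proof (intro conjI allI impI)
        fix b b' assume "b < k" "b' < k"
        then show "cake_value (v (k-1)) (B' b) = cake_value (v (k-1)) (B' b')"
          using B'_val[OF v] by simp
      next
        fix b assume b: "b < k"
        show "cake_value (v (k-1)) (X' k) \<le> cake_value (v (k-1)) (B' b)"
          using B'_val[OF v b] w_t[OF v1] by (simp add: X'_def)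
        show "cake_value (v k) (B' b) \<le> cake_value (v k) (X' k)"
          using P_val[OF v idx'[OF b]] by (simp add: B'_def X'_def)
      next
        fix j assume j: "k \<le> j \<and> Suc j < n"
        show "cake_value (v j) (X' (Suc j)) \<le> cake_value (v j) (X' j)"
        proof (cases "j = k")
          case True
          then show ?thesis
            using balancedD(2)[OF bal[OF v1], of w] w j by (simp add: X'_def)
        next
          case False
          then show ?thesis
            using balancedD(4)[OF bal[OF v1], of j] j by (simp add: X'_def)
        qed
        show "cake_value (v (Suc j)) (X' j) + cake_value (v (Suc j)) (Z' (Suc j)) \<le>
          cake_value (v (Suc j)) (X' (Suc j))"
        proof (cases "j = k")
          case True
          then show ?thesis
            using dom[OF v1] w j unfolding dominated_def by (simp add: X'_def Z'_def)
        next
          case False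
          then show ?thesis
            using balancedD(5)[OF bal[OF v1], of j] j by (simp add: X'_def Z'_def)
        qed
      qed
      have bound: "(\<Sum>b<k. f b) \<le> real k * K" if "\<And>b. b < k \<Longrightarrow> f b \<le> K" for f K
        using sum_bounded_above[of "{..<k}" f K] that by simp
      have Z'k: "cake_value (v k) (Z' k) = (\<Sum>b<k. cake_value (v k) (R b))"
        by (simp add: Z'_def)
      have "cake_value (v k) (Z' k) \<le> real k * (cake_value (v k) (X' k) - cake_value (v k) (B' r))"
        if "r < k"
      proof -
        have "cake_value (v k) (R b) \<le> cake_value (v k) (R m)" if "b < k" for b
          using m_ge[OF that] informed_cake_value[OF PR(3) v u2, of _ k] k that m by simp
        then have "cake_value (v k) (Z' k) \<le> real k * cake_value (v k) (R m)"
          unfolding Z'k by (rule bound)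
        also have "cake_value (v k) (R m) = cake_value (v k) (X' k) - cake_value (v k) (B' r)"
          using P_val(1)[OF v m] that by (simp add: B'_def X'_def r'_def)
        finally show ?thesis .
      qed
      moreover have "real (Suc k) * cake_value (v k) (Z' k) \<le> real k * cake_value (v k) C"
      proof -
        have "0 \<le> cake_value (v k) (P b)" if "b < k" for b
          using PR(2)[OF that] V2 V1_profiles k v
          by (intro informed_cake_value_nonneg[of N V2]) auto
        then have "cake_value (v k) (R b) \<le> cake_value (v k) (B w)" if "b < k" for b
          using P_val[OF v that] that by force
        then have "cake_value (v k) (Z' k) \<le> real k * cake_value (v k) (B w)"
          unfolding Z'k by (rule bound)
        then have "real (Suc k) * cake_value (v k) (Z' k) \<le>
            real (Suc k) * (real k * cake_value (v k) (B w))"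
          by (intro mult_left_mono) simp_all
        also have "\<dots> = real k * (\<Sum>b<Suc k. cake_value (v k) (B w))"
          by (simp only: sum_constant card_lessThan mult.left_commute)
        also have "(\<Sum>b<Suc k. cake_value (v k) (B w)) = (\<Sum>b<Suc k. cake_value (v k) (B b))"
          using w by (intro sum.cong eq[OF v1]) auto
        also have "\<dots> \<le> cake_value (v k) (stage_pieces n (Suc k) B X Z)"
        proof -
          have "0 \<le> (\<Sum>j\<in>{Suc k..<n}. cake_value (v k) (X j) + cake_value (v k) (Z j))"
            using inf v1 V1_profiles k
            by (intro sum_nonneg add_nonneg_nonneg informed_cake_value_nonneg[of N V1]) auto
          then show ?thesis by (simp add: stage_pieces_def del: sum.lessThan_Suc)
        qed
        also have "\<dots> = cake_value (v k) C"
          using V sub v1 V1 k by (intro informed_subdivides_cake_value[of N V]) auto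
        finally show ?thesis by (simp add: mult_left_mono)
      qed
      ultimately show "round_gain k r C v B' X' Z'"
        unfolding round_gain_def by blast
    qed
    with sub' inf' show "stage_result N n k C (round_gain k r C) V2"
      unfolding stage_result_def by blast
  qed
qed

section \<open>Accumulating rounds\<close>

text \<open>Round \<open>b\<close> opens a gap for bundle \<open>b\<close> of at least a
  \<open>k\<close>-th of the trimmings then left. Gaps never close, while the trimmings shrink by
  \<open>k/(k+1)\<close> per round. Crediting only the rounds after the first \<open>k\<close> gives
  one exponent for all bundles, the truncated \<open>r - k\<close>.\<close>

definition rounds_gain ::
  "nat \<Rightarrow> nat \<Rightarrow> profile \<Rightarrow> (nat \<Rightarrow> cake) \<Rightarrow> (nat \<Rightarrow> cake) \<Rightarrow> (nat \<Rightarrow> cake) \<Rightarrow> bool" where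
  "rounds_gain k r v B X Z \<longleftrightarrow> (\<forall>b<min r k.
    cake_value (v k) (Z k) \<le> real k * (real k / real (Suc k)) ^ (r - k) *
      (cake_value (v k) (X k) - cake_value (v k) (B b)))"

lemma rounds_gain_Suc:
  assumes k: "0 < k" "k < n"
    and bal: "balanced n k v B X Z" "balanced n k v B' X' Z'"
    and gain: "rounds_gain k r v B X Z" "round_gain k r (Z k) v B' X' Z'"
    and nonneg: "0 \<le> cake_value (v k) (Z' k)"
  shows "rounds_gain k (Suc r) v (\<lambda>b. B b + B' b) (\<lambda>j. X j + X' j)
    (\<lambda>j. if j = k then Z' k else Z j + Z' j)"
  unfolding rounds_gain_def
proof (intro allI impI)
  fix b assume b: "b < min (Suc r) k"
  define d where "d = cake_value (v k) (X k) - cake_value (v k) (B b)"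
  define d' where "d' = cake_value (v k) (X' k) - cake_value (v k) (B' b)"
  define q where "q = real k / real (Suc k)"
  have d: "0 \<le> d" "0 \<le> d'"
    using balancedD(3)[OF bal(1) k(2), of b] balancedD(3)[OF bal(2) k(2), of b] b
    by (auto simp: d_def d'_def)
  have q: "0 \<le> q" "q \<le> 1" by (auto simp: q_def)
  have shrink: "cake_value (v k) (Z' k) \<le> q * cake_value (v k) (Z k)"
    using gain(2) by (simp add: round_gain_def q_def field_simps)
  have "cake_value (v k) (Z' k) \<le> real k * q ^ (Suc r - k) * (d + d')"
  proof (cases "b = r")
    case True
    \<comment> \<open>Here \<open>r < k\<close>, so the exponent is still 0 and the new gap
      \<open>d'\<close> alone suffices.\<close>
    then have "cake_value (v k) (Z' k) \<le> real k * d'" "Suc r - k = 0"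
      using gain(2) b by (auto simp: round_gain_def d'_def)
    with d show ?thesis by (simp add: distrib_left add_increasing)
  next
    case False
    then have Z: "cake_value (v k) (Z k) \<le> real k * q ^ (r - k) * d"
      using gain(1) b by (auto simp: rounds_gain_def d_def q_def)
    have "cake_value (v k) (Z' k) \<le> q * (real k * q ^ (r - k) * d)"
      using shrink mult_left_mono[OF Z q(1)] by simp
    also have "\<dots> \<le> real k * q ^ (Suc r - k) * d"
    \<comment> \<open>For \<open>r < k\<close> the factor \<open>q\<close> is given away, as the
      exponent stays 0; later it raises the exponent by one.\<close>
    proof (cases "r < k")
      case True
      have "q * (real k * d) \<le> 1 * (real k * d)"
        using q d by (intro mult_right_mono) simp_all
      with True show ?thesis by simp
    next
      case False
      then show ?thesis by (simp add: Suc_diff_le)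
    qed
    also have "\<dots> \<le> real k * q ^ (Suc r - k) * (d + d')"
      using q d by (intro mult_left_mono) simp_all
    finally show ?thesis .
  qed
  then show "cake_value (v k) (if k = k then Z' k else Z k + Z' k) \<le>
      real k * (real k / real (Suc k)) ^ (Suc r - k) *
      (cake_value (v k) (X k + X' k) - cake_value (v k) (B b + B' b))"
    by (simp add: d_def d'_def q_def algebra_simps)
qed

text \<open>Every round runs on the current \<open>Z k\<close>, so the assumption on stage
  \<open>Suc k\<close> must cover all cakes and all states of knowledge.\<close>

lemma reaches_rounds:
  assumes V: "V \<subseteq> profiles N" "informed N V C" and k: "0 < k" "k < n" "n \<le> N"
    and stage: "\<And>V C. V \<subseteq> profiles N \<Longrightarrow> informed N V C \<Longrightarrow>
      reaches N (stage_result N n (Suc k) C (dominated n (Suc k))) c V"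
  shows "reaches N (stage_result N n k C (rounds_gain k r)) (r * (c + k * Suc N)) V"
proof (induction r)
  case 0
  \<comment> \<open>Before the first round the whole cake counts as trimmings.\<close>
  have "stage_pieces n k (\<lambda>_. {#}) (\<lambda>_. {#}) ((\<lambda>_. {#})(k := C)) = C"
    using k by (simp add: stage_pieces_split_off)
  then have "stage_result N n k C (rounds_gain k 0) V"
    unfolding stage_result_def using V(2)
    by - (rule exI[of _ "\<lambda>_. {#}"], rule exI[of _ "\<lambda>_. {#}"], rule exI[of _ "(\<lambda>_. {#})(k := C)"],
      simp add: subdivides.refl balanced_def rounds_gain_def)
  then show ?case by (rule reaches.now)
next
  case (Suc r)
  have "reaches N (stage_result N n k C (rounds_gain k (Suc r)))
    (r * (c + k * Suc N) + (c + k * Suc N)) V"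
  proof (rule reaches_bind[OF Suc.IH])
    fix V1 assume V1: "V1 \<subseteq> V" and "stage_result N n k C (rounds_gain k r) V1"
    then obtain B X Z where BXZ: "subdivides C (stage_pieces n k B X Z)"
      "informed N V1 (stage_pieces n k B X Z)"
      "\<forall>v\<in>V1. balanced n k v B X Z \<and> rounds_gain k r v B X Z"
      unfolding stage_result_def by blast
    have V1N: "V1 \<subseteq> profiles N" using V V1 by blast
    have "informed N V1 (Z k)" using BXZ(2) k by simp
    then have "reaches N (stage_result N n k (Z k) (round_gain k r (Z k))) (c + k * Suc N) V1"
      using V1N k by (intro reaches_round stage)
    then show "reaches N (stage_result N n k C (rounds_gain k (Suc r))) (c + k * Suc N) V1"
    proof (rule reaches_weaken)
      fix V2 assume V2: "V2 \<subseteq> V1" and "stage_result N n k (Z k) (round_gain k r (Z k)) V2"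
      then obtain B' X' Z' where BXZ': "subdivides (Z k) (stage_pieces n k B' X' Z')"
        "informed N V2 (stage_pieces n k B' X' Z')"
        "\<forall>v\<in>V2. balanced n k v B' X' Z' \<and> round_gain k r (Z k) v B' X' Z'"
        unfolding stage_result_def by blast
      let ?B = "\<lambda>b. B b + B' b" and ?X = "\<lambda>j. X j + X' j"
        and ?Z = "\<lambda>j. if j = k then Z' k else Z j + Z' j"
      have eq: "stage_pieces n k ?B ?X ?Z =
        ((\<Sum>b<k. B b) + X k + (\<Sum>j\<in>{Suc k..<n}. X j + Z j)) + stage_pieces n k B' X' Z'"
      proof -
        have "(\<Sum>j\<in>{Suc k..<n}. ?X j + ?Z j) = (\<Sum>j\<in>{Suc k..<n}. (X j + Z j) + (X' j + Z' j))"
          by (intro sum.cong) (auto simp: ac_simps)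
        then show ?thesis
          unfolding stage_pieces_split_off[OF k(2)] sum.distrib by (simp add: ac_simps)
      qed
      have "subdivides C (stage_pieces n k ?B ?X ?Z)"
        unfolding eq using subdivides_trans[OF BXZ(1)]
          subdivides_add[OF subdivides.refl BXZ'(1)]
        by (simp add: stage_pieces_split_off[OF k(2), of B])
      moreover have "informed N V2 (stage_pieces n k ?B ?X ?Z)"
        using BXZ'(2) informed_mono[OF BXZ(2) V2] by simp
      moreover have "\<forall>v\<in>V2. balanced n k v ?B ?X ?Z \<and> rounds_gain k (Suc r) v ?B ?X ?Z"
      proof
        fix v assume v: "v \<in> V2"
        have "0 \<le> cake_value (v k) (Z' k)"
          using BXZ'(2) k V2 V1N v by (intro informed_cake_value_nonneg[of N V2]) auto
        moreover have "v \<in> V1" using v V2 by blast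
        ultimately show "balanced n k v ?B ?X ?Z \<and> rounds_gain k (Suc r) v ?B ?X ?Z"
          using BXZ(3) BXZ'(3) v k
          by (intro conjI balanced_add rounds_gain_Suc[where n = n]) simp_all
      qed
      ultimately show "stage_result N n k C (rounds_gain k (Suc r)) V2"
        unfolding stage_result_def
          by - (rule exI[of _ ?B], rule exI[of _ ?X], rule exI[of _ ?Z], intro conjI)
    qed
  qed
  then show ?case by (simp only: mult_Suc add.commute[of "c + k * Suc N"])
qed

section \<open>Number of rounds and of queries\<close>

text \<open>By Bernoulli, the reciprocal \<open>(1 + 1/k)^(k+1)\<close> is at least
  \<open>1 + (k+1)/k\<close>, hence at least 2.\<close>

lemma power_ratio_le_half: "0 < k \<Longrightarrow> (real k / real (Suc k)) ^ Suc k \<le> 1 / 2"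
proof -
  assume k: "0 < k"
  have "2 \<le> 1 + real (Suc k) * (1 / real k)"
    using k by (simp add: field_simps)
  also have "\<dots> \<le> (1 + 1 / real k) ^ Suc k"
    by (rule Bernoulli_inequality) (use k in \<open>simp add: order_trans[of _ 0]\<close>)
  also have "1 + 1 / real k = inverse (real k / real (Suc k))"
    using k by (simp add: field_simps)
  finally have "2 \<le> inverse ((real k / real (Suc k)) ^ Suc k)"
    by (simp only: power_inverse)
  moreover have "0 < (real k / real (Suc k)) ^ Suc k"
    using k by simp
  ultimately show ?thesis
    by (metis inverse_eq_divide inverse_inverse_eq le_imp_inverse_le zero_less_numeral)
qed

text \<open>Beyond the first \<open>k\<close> rounds at least \<open>Suc k * L\<close> remain, since
  \<open>Suc k \<le> n\<close>. Each block of \<open>Suc k\<close> rounds halves the bound, and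
  \<open>L\<close> halvings absorb the factor \<open>k \<le> 2 ^ L\<close>.\<close>

lemma rounds_suffice:
  assumes "0 < k" "k < n" "n \<le> 2 ^ L"
  shows "real k * (real k / real (Suc k)) ^ (n * Suc L - k) \<le> 1"
proof -
  have "Suc k * L \<le> n * L"
    using assms(2) by (intro mult_le_mono1 Suc_leI)
  then have "Suc k * L \<le> n * Suc L - k"
    using assms(2) unfolding mult_Suc_right by linarith
  then have "(real k / real (Suc k)) ^ (n * Suc L - k) \<le> (real k / real (Suc k)) ^ (Suc k * L)"
    by (rule power_decreasing) simp_all
  also have "\<dots> = ((real k / real (Suc k)) ^ Suc k) ^ L"
    by (rule power_mult)
  also have "\<dots> \<le> (1 / 2) ^ L"
    by (intro power_mono power_ratio_le_half assms(1) zero_le_power) simp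
  finally have "real k * (real k / real (Suc k)) ^ (n * Suc L - k) \<le> real k * (1 / 2) ^ L"
    by (intro mult_left_mono) simp_all
  also have "real k \<le> real (2 ^ L)"
    unfolding of_nat_le_iff using assms(2,3) by linarith
  then have "real k * (1 / 2) ^ L \<le> 2 ^ L * (1 / 2) ^ L"
    by (intro mult_right_mono) simp_all
  also have "\<dots> = (1::real)"
    by (simp add: power_one_over)
  finally show ?thesis .
qed

text \<open>\<open>d\<close> counts the agents already served. Each of \<open>M\<close> rounds runs
  the previous stage and trims; \<open>N * Suc N\<close> bounds a trimming as well as the initial
  equal division.\<close>

primrec stage_cost :: "nat \<Rightarrow> nat \<Rightarrow> nat \<Rightarrow> nat" where
  "stage_cost N M 0 = N * Suc N"
| "stage_cost N M (Suc d) = M * (stage_cost N M d + N * Suc N)"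

text \<open>Adding \<open>N * Suc N\<close> turns the affine recursion into a multiplicative one
  with factor \<open>2 * M\<close>.\<close>

lemma stage_cost_le:
  assumes "1 \<le> M"
  shows "stage_cost N M d + N * Suc N \<le> 2 * (N * Suc N) * (2 * M) ^ d"
proof (induction d)
  case (Suc d)
  have "stage_cost N M (Suc d) + N * Suc N \<le>
      M * (stage_cost N M d + N * Suc N) + M * (stage_cost N M d + N * Suc N)"
    using mult_le_mono[OF assms, of "N * Suc N" "stage_cost N M d + N * Suc N"] by simp
  also have "\<dots> = 2 * M * (stage_cost N M d + N * Suc N)"
    by simp
  also have "\<dots> \<le> 2 * M * (2 * (N * Suc N) * (2 * M) ^ d)"
    using Suc.IH by (rule mult_le_mono2)
  finally show ?case by (simp add: ac_simps)
qed simp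

lemma reaches_stage:
  assumes "V \<subseteq> profiles N" "informed N V C" "0 < k" "n = k + d" "n \<le> N" "n \<le> 2 ^ L"
  shows "reaches N (stage_result N n k C (dominated n k)) (stage_cost N (n * Suc L) d) V"
  using assms(1-4)
proof (induction d arbitrary: k V C)
  case 0
  \<comment> \<open>With \<open>k = n\<close> nobody has been served: the last agent divides
    equally, and the other conditions are vacuous.\<close>
  have "reaches N (\<lambda>V'. \<exists>B. subdivides C (\<Sum>b<n. B b) \<and> informed N V' (\<Sum>b<n. B b) \<and>
    (\<forall>v\<in>V'. \<forall>b<n. \<forall>b'<n. cake_value (v (n-1)) (B b) = cake_value (v (n-1)) (B b'))) (n * Suc N) V"
    using 0 assms(5) by (intro reaches_equal_division) auto
  then have "reaches N (stage_result N n k C (dominated n k)) (n * Suc N) V"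
  proof (rule reaches_weaken)
    fix V' assume "\<exists>B. subdivides C (\<Sum>b<n. B b) \<and> informed N V' (\<Sum>b<n. B b) \<and>
      (\<forall>v\<in>V'. \<forall>b<n. \<forall>b'<n. cake_value (v (n-1)) (B b) = cake_value (v (n-1)) (B b'))"
    then obtain B where B: "subdivides C (\<Sum>b<n. B b)" "informed N V' (\<Sum>b<n. B b)"
      "\<forall>v\<in>V'. \<forall>b<n. \<forall>b'<n. cake_value (v (n-1)) (B b) = cake_value (v (n-1)) (B b')"
      by blast
    have "k = n" using 0 by simp
    have "balanced n n v B (\<lambda>_. {#}) (\<lambda>_. {#}) \<and> dominated n n v B (\<lambda>_. {#}) (\<lambda>_. {#})"
      if "v \<in> V'" for v
      unfolding balanced_def dominated_def
      by (intro conjI allI impI) (rule B(3)[rule_format, OF that], simp_all)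
    moreover have "stage_pieces n n B (\<lambda>_. {#}) (\<lambda>_. {#}) = (\<Sum>b<n. B b)"
      by (simp add: stage_pieces_def)
    ultimately show "stage_result N n k C (dominated n k) V'"
      unfolding stage_result_def \<open>k = n\<close> using B(1,2)
      by - (rule exI[of _ B], rule exI[of _ "\<lambda>_. {#}"], rule exI[of _ "\<lambda>_. {#}"], simp)
  qed
  then show ?case
    unfolding stage_cost.simps by (rule reaches_mono) (intro mult_le_mono1 assms(5))
next
  case (Suc d)
  have k: "0 < k" "k < n" using Suc.prems by auto
  let ?c = "stage_cost N (n * Suc L) d"
  have "reaches N (stage_result N n k C (rounds_gain k (n * Suc L)))
    (n * Suc L * (?c + k * Suc N)) V"
  proof (rule reaches_rounds[OF Suc.prems(1,2) k assms(5)])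
    fix V C assume "V \<subseteq> profiles N" "informed N V C"
    then show "reaches N (stage_result N n (Suc k) C (dominated n (Suc k))) ?c V"
      using Suc.prems(4) by (intro Suc.IH) auto
  qed
  then have "reaches N (stage_result N n k C (dominated n k)) (n * Suc L * (?c + k * Suc N)) V"
  proof (rule reaches_weaken)
    fix V' assume "stage_result N n k C (rounds_gain k (n * Suc L)) V'"
    then obtain B X Z where BXZ: "subdivides C (stage_pieces n k B X Z)"
      "informed N V' (stage_pieces n k B X Z)"
      "\<forall>v\<in>V'. balanced n k v B X Z \<and> rounds_gain k (n * Suc L) v B X Z"
      unfolding stage_result_def by (elim exE conjE) (rule that)
    have "dominated n k v B X Z"
      if bal: "balanced n k v B X Z" and gain: "rounds_gain k (n * Suc L) v B X Z" for v
      unfolding dominated_def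
    proof (intro impI allI)
      fix b assume b: "b < k"
      let ?d = "cake_value (v k) (X k) - cake_value (v k) (B b)"
      \<comment> \<open>Every bundle has had its round, so the gain covers all
        \<open>b < k\<close>.\<close>
      have "k \<le> n * Suc L" using k by simp
      then have "cake_value (v k) (Z k) \<le>
        real k * (real k / real (Suc k)) ^ (n * Suc L - k) * ?d"
        using gain b unfolding rounds_gain_def by (simp add: min_absorb2)
      also have "\<dots> \<le> 1 * ?d"
        using balancedD(3)[OF bal k(2) b]
        by (intro mult_right_mono rounds_suffice k assms(6)) simp
      finally show "cake_value (v k) (B b) + cake_value (v k) (Z k) \<le> cake_value (v k) (X k)"
        by simp
    qed
    then have "\<forall>v\<in>V'. balanced n k v B X Z \<and> dominated n k v B X Z"
      using BXZ(3) by simp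
    with BXZ(1,2) show "stage_result N n k C (dominated n k) V'"
      unfolding stage_result_def by (intro exI conjI)
  qed
  then show ?case
  proof (rule reaches_mono)
    show "n * Suc L * (?c + k * Suc N) \<le> stage_cost N (n * Suc L) (Suc d)"
      unfolding stage_cost.simps using k assms(5)
      by (intro mult_le_mono2 add_left_mono mult_le_mono1) linarith
  qed
qed

section \<open>Assembling the allocation\<close>

definition line_envy_free :: "nat \<Rightarrow> profile \<Rightarrow> (nat \<Rightarrow> cake) \<Rightarrow> bool" where
  "line_envy_free n v A \<longleftrightarrow> (\<forall>i. Suc i < n \<longrightarrow>
    cake_value (v i) (A (Suc i)) \<le> cake_value (v i) (A i) \<and>
    cake_value (v (Suc i)) (A i) \<le> cake_value (v (Suc i)) (A (Suc i)))"

definition line_result :: "nat \<Rightarrow> nat \<Rightarrow> cake \<Rightarrow> (nat \<Rightarrow> cake) \<Rightarrow> profile set \<Rightarrow> bool" where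
  "line_result N n C A V \<longleftrightarrow> subdivides C (\<Sum>i<n. A i) \<and> informed N V (\<Sum>i<n. A i) \<and>
    (\<forall>v\<in>V. line_envy_free n v A)"

lemma line_result_mono: "line_result N n C A V \<Longrightarrow> V' \<subseteq> V \<Longrightarrow> line_result N n C A V'"
  unfolding line_result_def using informed_mono by blast

section \<open>Dividing the cakes set aside\<close>

text \<open>The cakes are divided one after another; earlier results persist because knowledge only
  grows.\<close>

lemma reaches_shares:
  assumes "V \<subseteq> profiles N" "\<And>j. j < p \<Longrightarrow> informed N V (Z j)"
    and sub: "\<And>j V. j < p \<Longrightarrow> V \<subseteq> profiles N \<Longrightarrow> informed N V (Z j) \<Longrightarrow>
      reaches N (\<lambda>V'. \<exists>A. line_result N (Suc j) (Z j) A V') (c j) V"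
  shows "reaches N (\<lambda>V'. \<exists>S. \<forall>j<p. line_result N (Suc j) (Z j) (S j) V') (\<Sum>j<p. c j) V"
  using assms(2) sub
proof (induction p)
  case 0
  show ?case by (rule reaches.now) simp
next
  case (Suc p)
  have "reaches N (\<lambda>V'. \<exists>S. \<forall>j<Suc p. line_result N (Suc j) (Z j) (S j) V')
    ((\<Sum>j<p. c j) + c p) V"
  proof (rule reaches_bind)
    show "reaches N (\<lambda>V'. \<exists>S. \<forall>j<p. line_result N (Suc j) (Z j) (S j) V') (\<Sum>j<p. c j) V"
      using Suc.prems by (intro Suc.IH) simp_all
    fix V' assume "\<exists>S. \<forall>j<p. line_result N (Suc j) (Z j) (S j) V'" and V': "V' \<subseteq> V"
    then obtain S where S: "\<And>j. j < p \<Longrightarrow> line_result N (Suc j) (Z j) (S j) V'"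
      by blast
    have "reaches N (\<lambda>V'. \<exists>A. line_result N (Suc p) (Z p) A V') (c p) V'"
      using V' assms(1) by (intro Suc.prems(2) informed_mono[OF Suc.prems(1) V']) auto
    then show "reaches N (\<lambda>V'. \<exists>S. \<forall>j<Suc p. line_result N (Suc j) (Z j) (S j) V') (c p) V'"
    proof (rule reaches_weaken)
      fix V'' assume "\<exists>A. line_result N (Suc p) (Z p) A V''" and V'': "V'' \<subseteq> V'"
      then obtain A where A: "line_result N (Suc p) (Z p) A V''" by blast
      have "line_result N (Suc j) (Z j) ((S(p := A)) j) V''" if "j < Suc p" for j
        using that A line_result_mono[OF S V''] by (cases "j = p") simp_all
      then show "\<exists>S. \<forall>j<Suc p. line_result N (Suc j) (Z j) (S j) V''"
        by blast
    qed
  qed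
  then show ?case by simp
qed

text \<open>Agent \<open>i\<close> also gets a share \<open>S j i\<close> of each
  \<open>Z (Suc j)\<close> with \<open>j \<ge> i\<close>. For \<open>j > i\<close>, agents
  \<open>i\<close> and \<open>Suc i\<close> share that cake without envy. From
  \<open>Z (Suc i)\<close> only agent \<open>i\<close> profits, and agent \<open>Suc i\<close> would
  tolerate its getting all of it.\<close>

lemma line_envy_free_combine:
  assumes V: "V \<subseteq> profiles N" "v \<in> V" "Suc m \<le> N"
    and bal: "balanced (Suc m) 1 v B X Z" and dom: "dominated (Suc m) 1 v B X Z"
    and shares: "\<And>j. j < m \<Longrightarrow> line_result N (Suc j) (Z (Suc j)) (S j) V"
    and Z: "\<And>j. j < m \<Longrightarrow> informed N V (Z (Suc j))"
  shows "line_envy_free (Suc m) v (\<lambda>i. (if i = 0 then B 0 else X i) + (\<Sum>j\<in>{i..<m}. S j i))"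
  unfolding line_envy_free_def
proof (intro allI impI)
  fix i assume "Suc i < Suc m"
  then have i: "i < m" by simp
  \<comment> \<open>At stage 1 the only bundle, \<open>B 0\<close>, falls to agent 0. Its edge to
    agent 1 is safe by balance and domination, the later edges by balance alone.\<close>
  define Y where "Y i = (if i = 0 then B 0 else X i)" for i
  have Y: "cake_value (v i) (Y (Suc i)) \<le> cake_value (v i) (Y i)"
    "cake_value (v (Suc i)) (Y i) + cake_value (v (Suc i)) (Z (Suc i)) \<le>
      cake_value (v (Suc i)) (Y (Suc i))"
    using balancedD(2)[OF bal, of 0] balancedD(4,5)[OF bal, of i] dom i
    by (auto simp: Y_def dominated_def)
  have nonneg: "0 \<le> cake_value (v a) (S j b)" if "j < m" "b \<le> j" "a \<le> m" for a b j
    using shares[OF that(1)] V that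
    by (intro informed_cake_value_nonneg[of N V]) (auto simp: line_result_def simp del: sum.lessThan_Suc)
  have split: "(\<Sum>j\<in>{i..<m}. f j) = f i + (\<Sum>j\<in>{Suc i..<m}. f j)" for f :: "nat \<Rightarrow> real"
    using i by (rule sum.atLeast_Suc_lessThan)
  have edge: "cake_value (v i) (S j (Suc i)) \<le> cake_value (v i) (S j i)"
    "cake_value (v (Suc i)) (S j i) \<le> cake_value (v (Suc i)) (S j (Suc i))"
    if "j \<in> {Suc i..<m}" for j
    using shares[of j] that V(2) unfolding line_result_def line_envy_free_def by auto
  have le: "(\<Sum>j\<in>{Suc i..<m}. cake_value (v i) (S j (Suc i))) \<le>
      (\<Sum>j\<in>{Suc i..<m}. cake_value (v i) (S j i))"
    "(\<Sum>j\<in>{Suc i..<m}. cake_value (v (Suc i)) (S j i)) \<le>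
      (\<Sum>j\<in>{Suc i..<m}. cake_value (v (Suc i)) (S j (Suc i)))"
    by (intro sum_mono edge; assumption)+
  have "cake_value (v i) (Y (Suc i)) + (\<Sum>j\<in>{Suc i..<m}. cake_value (v i) (S j (Suc i))) \<le>
      cake_value (v i) (Y i) + (\<Sum>j\<in>{i..<m}. cake_value (v i) (S j i))"
    unfolding split using nonneg[of i i i] i Y(1) le(1) by simp
  moreover have "cake_value (v (Suc i)) (S i i) \<le> cake_value (v (Suc i)) (Z (Suc i))"
  proof -
    have "(\<Sum>b<Suc i. cake_value (v (Suc i)) (S i b)) = cake_value (v (Suc i)) (Z (Suc i))"
      using informed_subdivides_cake_value[OF Z[OF i] _ V(1,2), of "\<Sum>b<Suc i. S i b" "Suc i"]
        shares[OF i] i V(3)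
      by (simp add: line_result_def)
    moreover have "cake_value (v (Suc i)) (S i i) \<le> (\<Sum>b<Suc i. cake_value (v (Suc i)) (S i b))"
      using nonneg[of i _ "Suc i"] i by (intro member_le_sum) auto
    ultimately show ?thesis by simp
  qed
  then have "cake_value (v (Suc i)) (Y i) + (\<Sum>j\<in>{i..<m}. cake_value (v (Suc i)) (S j i)) \<le>
      cake_value (v (Suc i)) (Y (Suc i)) + (\<Sum>j\<in>{Suc i..<m}. cake_value (v (Suc i)) (S j (Suc i)))"
    unfolding split using Y(2) le(2) by linarith
  ultimately show "cake_value (v i) ((if Suc i = 0 then B 0 else X (Suc i)) + (\<Sum>j\<in>{Suc i..<m}. S j (Suc i)))
      \<le> cake_value (v i) ((if i = 0 then B 0 else X i) + (\<Sum>j\<in>{i..<m}. S j i)) \<and>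
    cake_value (v (Suc i)) ((if i = 0 then B 0 else X i) + (\<Sum>j\<in>{i..<m}. S j i)) \<le>
      cake_value (v (Suc i)) ((if Suc i = 0 then B 0 else X (Suc i)) + (\<Sum>j\<in>{Suc i..<m}. S j (Suc i)))"
    unfolding Y_def[symmetric] by simp
qed

lemma sum_shares:
  fixes S :: "nat \<Rightarrow> nat \<Rightarrow> 'a::comm_monoid_add"
  shows "(\<Sum>i<Suc m. \<Sum>j\<in>{i..<m}. S j i) = (\<Sum>j<m. \<Sum>i<Suc j. S j i)"
proof -
  have "(\<Sum>i<Suc m. \<Sum>j\<in>{i..<m}. S j i) = (\<Sum>i<Suc m. \<Sum>j\<in>{j\<in>{..<m}. i \<le> j}. S j i)"
    by (intro sum.cong) auto
  also have "\<dots> = (\<Sum>j<m. \<Sum>i\<in>{i\<in>{..<Suc m}. i \<le> j}. S j i)"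
    by (rule sum.swap_restrict) simp_all
  also have "\<dots> = (\<Sum>j<m. \<Sum>i<Suc j. S j i)"
    by (intro sum.cong) auto
  finally show ?thesis .
qed

lemma stage_pieces_1:
  "stage_pieces (Suc m) 1 B X Z =
    (\<Sum>i<Suc m. if i = 0 then B 0 else X i) + (\<Sum>j<m. Z (Suc j))"
  unfolding stage_pieces_def sum.lessThan_Suc_shift sum.distrib One_nat_def
    sum.atLeast_Suc_lessThan_Suc_shift
  by (simp add: atLeast0LessThan add.assoc)

lemma double_sum_power_le:
  fixes x :: nat
  assumes "3 \<le> x"
  shows "2 * (\<Sum>j<m. x ^ j) \<le> x ^ m"
proof (induction m)
  case (Suc m)
  have "2 * (\<Sum>j<Suc m. x ^ j) \<le> 3 * x ^ m"
    using Suc.IH by simp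
  also have "\<dots> \<le> x ^ Suc m"
    using assms by simp
  finally show ?case .
qed simp

text \<open>\<open>a * x ^ m\<close> pays for the stages of a line of \<open>Suc m\<close> agents,
  \<open>a * x ^ Suc j\<close> for the cake set aside for \<open>Suc j\<close> agents. The geometric
  sum fits into one further factor \<open>x\<close>.\<close>

lemma line_cost_le:
  fixes x a :: nat
  assumes "4 \<le> x"
  shows "a * x ^ m + (\<Sum>j<m. a * x ^ Suc j) \<le> a * x ^ Suc m"
proof -
  have "2 * (x ^ m + x * (\<Sum>j<m. x ^ j)) \<le> 2 * x ^ m + x * x ^ m"
    using mult_le_mono2[OF double_sum_power_le[of x m], of x] assms by (simp add: algebra_simps)
  also have "\<dots> \<le> 2 * (x * x ^ m)"
    using mult_le_mono1[of 2 x "x ^ m"] assms by simp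
  finally have "x ^ m + x * (\<Sum>j<m. x ^ j) \<le> x ^ Suc m"
    by simp
  then have "a * (x ^ m + x * (\<Sum>j<m. x ^ j)) \<le> a * x ^ Suc m"
    by (rule mult_le_mono2)
  then show ?thesis
    by (simp add: sum_distrib_left algebra_simps)
qed

text \<open>Stage 1 serves a line of \<open>Suc m\<close> agents; then each \<open>Z (Suc j)\<close>
  is divided along the shorter line \<open>0, ..., j\<close>. \<open>N\<close> and \<open>L\<close>
  remain those of the full line, since all \<open>N\<close> agents evaluate every new interval and
  the base of the power must be the same at each level.\<close>

lemma reaches_line:
  assumes "2 \<le> N" "N \<le> 2 ^ L"
    and "V \<subseteq> profiles N" "informed N V C" "0 < n" "n \<le> N"
  shows "reaches N (\<lambda>V'. \<exists>A. line_result N n C A V')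
    (2 * (N * Suc N) * (2 * (N * Suc L)) ^ n) V"
  using assms(3-6)
proof (induction n arbitrary: V C rule: less_induct)
  case (less n)
  obtain m where n: "n = Suc m" using less.prems(3) gr0_implies_Suc by blast
  define a where "a = 2 * (N * Suc N)"
  define x where "x = 2 * (N * Suc L)"
  have x: "4 \<le> x" using assms(1) by (simp add: x_def)
  have "reaches N (stage_result N n 1 C (dominated n 1)) (stage_cost N (n * Suc L) m) V"
    using less.prems assms(2) n by (intro reaches_stage) auto
  moreover have "stage_cost N (n * Suc L) m \<le> a * x ^ m"
  proof -
    have "stage_cost N (n * Suc L) m \<le> 2 * (N * Suc N) * (2 * (n * Suc L)) ^ m"
      using stage_cost_le[of "n * Suc L" N m] n by simp
    also have "\<dots> \<le> a * x ^ m"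
      unfolding a_def x_def using less.prems(4)
      by (intro mult_le_mono2 power_mono mult_le_mono1) auto
    finally show ?thesis .
  qed
  ultimately have "reaches N (stage_result N n 1 C (dominated n 1)) (a * x ^ m) V"
    by (rule reaches_mono)
  then have "reaches N (\<lambda>V'. \<exists>A. line_result N n C A V') (a * x ^ m + (\<Sum>j<m. a * x ^ Suc j)) V"
  proof (rule reaches_bind)
    fix V1 assume V1: "V1 \<subseteq> V" and "stage_result N n 1 C (dominated n 1) V1"
    then obtain B X Z where sub: "subdivides C (stage_pieces n 1 B X Z)"
      and inf: "informed N V1 (stage_pieces n 1 B X Z)"
      and bal: "\<forall>v\<in>V1. balanced n 1 v B X Z \<and> dominated n 1 v B X Z"
      unfolding stage_result_def by (elim exE conjE) (rule that)
    have V1N: "V1 \<subseteq> profiles N" using V1 less.prems(1) by blast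
    have infZ: "informed N V1 (Z (Suc j))" if "j < m" for j
      using inf that n by simp
    have "reaches N (\<lambda>V'. \<exists>S. \<forall>j<m. line_result N (Suc j) (Z (Suc j)) (S j) V')
      (\<Sum>j<m. a * x ^ Suc j) V1"
    proof (rule reaches_shares[OF V1N infZ])
      fix j V assume "j < m" "V \<subseteq> profiles N" "informed N V (Z (Suc j))"
      then show "reaches N (\<lambda>V'. \<exists>A. line_result N (Suc j) (Z (Suc j)) A V') (a * x ^ Suc j) V"
        unfolding a_def x_def using n less.prems(4) by (intro less.IH) auto
    qed
    then show "reaches N (\<lambda>V'. \<exists>A. line_result N n C A V') (\<Sum>j<m. a * x ^ Suc j) V1"
    proof (rule reaches_weaken)
      fix V2 assume V2: "V2 \<subseteq> V1"
        and "\<exists>S. \<forall>j<m. line_result N (Suc j) (Z (Suc j)) (S j) V2"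
      then obtain S where S: "\<And>j. j < m \<Longrightarrow> line_result N (Suc j) (Z (Suc j)) (S j) V2"
        by blast
      define A where "A i = (if i = 0 then B 0 else X i) + (\<Sum>j\<in>{i..<m}. S j i)" for i
      have sum: "(\<Sum>i<n. A i) =
          (\<Sum>i<Suc m. if i = 0 then B 0 else X i) + (\<Sum>j<m. \<Sum>i<Suc j. S j i)"
        unfolding n A_def sum.distrib sum_shares ..
      have "subdivides (stage_pieces n 1 B X Z) (\<Sum>i<n. A i)"
        unfolding n sum[unfolded n] stage_pieces_1
        by (intro subdivides_add subdivides.refl subdivides_sum)
          (use S in \<open>auto simp: line_result_def simp del: sum.lessThan_Suc\<close>)
      then have "subdivides C (\<Sum>i<n. A i)"
        by (rule subdivides_trans[OF sub])
      moreover have "informed N V2 (\<Sum>i<n. A i)"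
      proof -
        have "informed N V2 (if i = 0 then B 0 else X i)" if "i < Suc m" for i
          using informed_mono[OF inf V2] that n by simp
        moreover have "informed N V2 (\<Sum>i<Suc j. S j i)" if "j < m" for j
          using S[OF that] by (simp add: line_result_def)
        ultimately show ?thesis
          unfolding sum by (simp del: sum.lessThan_Suc)
      qed
      moreover have "line_envy_free n v A" if "v \<in> V2" for v
      proof -
        have "V2 \<subseteq> profiles N" "v \<in> V1" using V1N V2 that by blast+
        then show ?thesis
          unfolding A_def n using bal S informed_mono[OF infZ V2] less.prems(4) n that
          by (intro line_envy_free_combine[of V2 N v m B X Z S]) auto
      qed
      ultimately show "\<exists>A. line_result N n C A V2"
        unfolding line_result_def by blast
    qed
  qed
  then have "reaches N (\<lambda>V'. \<exists>A. line_result N n C A V') (a * x ^ n) V"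
    by (rule reaches_mono) (unfold n, rule line_cost_le[OF x])
  then show ?case by (simp only: a_def x_def)
qed

section \<open>From multisets to allocations\<close>

lemma piece_value_eq: "piece_value v P = cake_value v (mset P)"
  unfolding piece_value_def cake_value_def mset_map[symmetric] sum_mset_sum_list ..

lemma nth_pair_subseteq:
  assumes "p < length xs" "q < length xs" "p \<noteq> q"
  shows "{#xs ! p, xs ! q#} \<subseteq># mset xs"
proof -
  have less: "{#xs ! i, xs ! j#} \<subseteq># mset xs" if "i < j" "j < length xs" for i j
  proof -
    have "mset xs = mset (take j xs) + add_mset (xs ! j) (mset (drop (Suc j) xs))"
      using id_take_nth_drop[OF that(2)] by (metis mset.simps(2) mset_append)
    moreover have "xs ! i \<in># mset (take j xs)"
      using that by (auto simp: in_set_conv_nth)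
    then obtain M where "mset (take j xs) = add_mset (xs ! i) M"
      using multi_member_split by metis
    ultimately show ?thesis by simp
  qed
  show ?thesis
    using less[of p q] less[of q p] assms by (cases "p < q") (simp_all add: add_mset_commute)
qed

lemma line_local_envy_freeI:
  assumes sub: "subdivides {#(0,1)#} (\<Sum>i<n. A i)" and ef: "line_envy_free n v A"
    and lists: "\<And>i. mset (F i) = A i"
  shows "line_local_envy_free n v F"
proof -
  have unit: "inside_unit {#(0,1)#}" "non_overlapping {#(0,1)#}"
    by (simp_all add: inside_unit_def non_overlapping_def)
  have A_sub: "A i \<subseteq># (\<Sum>i<n. A i)" if "i < n" for i
    using that by (simp add: sum.remove[of "{..<n}" i])
  have inside: "inside_unit (\<Sum>i<n. A i)"
    using subdivides_inside_unit[OF sub unit(1)] .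
  have "0 \<le> a \<and> a \<le> b \<and> b \<le> 1" if "i < n" "(a,b) \<in> set (F i)" for i a b
    using inside mset_subset_eqD[OF A_sub[OF that(1)], of "(a,b)"] that(2) lists[of i, symmetric]
    by (force simp: inside_unit_def)
  then have bounds: "\<forall>i<n. \<forall>(a,b)\<in>set (F i). 0 \<le> a \<and> a \<le> b \<and> b \<le> 1"
    by blast
  have disjoint: "snd (F i ! p) \<le> fst (F j ! q) \<or> snd (F j ! q) \<le> fst (F i ! p)"
    if "i < n" "j < n" "p < length (F i)" "q < length (F j)" "(i,p) \<noteq> (j,q)" for i j p q
  proof -
    have "{#F i ! p, F j ! q#} \<subseteq># (\<Sum>i<n. A i)"
    proof (cases "i = j")
      case True
      then show ?thesis
        using nth_pair_subseteq[of p "F i" q] that lists[of i] A_sub[OF that(1)]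
        by (auto intro: subset_mset.order_trans)
    next
      case False
      have "F i ! p \<in># A i" "F j ! q \<in># A j"
        using that lists[symmetric] by simp_all
      then have "{#F i ! p#} + {#F j ! q#} \<subseteq># A i + A j"
        by (intro subset_mset.add_mono) simp_all
      also have "\<dots> \<subseteq># (\<Sum>i<n. A i)"
        using that(1,2) False by (simp add: sum.remove[of "{..<n}" i] sum.remove[of "{..<n} - {i}" j])
      finally show ?thesis by (simp add: add_mset_commute)
    qed
    then show ?thesis
      using subdivides_non_overlapping[OF sub unit] unfolding non_overlapping_def by blast
  qed
  have "set_mset (\<Sum>i<n. A i) = (\<Union>i<n. set (F i))"
  proof (induction n)
    case (Suc n)
    then show ?case using lists[of n, symmetric] by (auto simp: lessThan_Suc)
  qed simp
  then have union: "(\<Union>i<n. \<Union>(a,b)\<in>set (F i). {a..b}) = {0..1}"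
    using subdivides_Union[OF sub unit(1)] by simp
  show ?thesis
    unfolding line_local_envy_free_def is_allocation_def piece_value_eq lists
    using bounds disjoint union ef unfolding line_envy_free_def by blast
qed

lemma line_protocol:
  assumes "2 \<le> n" "n \<le> 2 ^ L"
  shows "\<exists>P. \<forall>v\<in>profiles n. rw_correct n v P (2 * (n * Suc n) * (2 * (n * Suc L)) ^ n)"
proof (rule reaches_protocol)
  have "u 0 1 = 1" if "valuation u" for u
    using that by (simp only: valuation_def)
  \<comment> \<open>Normalization makes the uncut cake known before any query.\<close>
  then have one: "v i 0 1 = 1" if "v \<in> profiles n" "i < n" for v i
    using that by (simp add: profiles_def)
  have "v i 0 1 = v' i 0 1" if "v \<in> profiles n" "v' \<in> profiles n" "i < n" for v v' i
    using one[OF that(1,3)] one[OF that(2,3)] by simp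
  then have "informed n (profiles n) {#(0,1)#}"
    unfolding informed_def by (simp add: inside_unit_def)
  then have "reaches n (\<lambda>V'. \<exists>A. line_result n n {#(0,1)#} A V')
    (2 * (n * Suc n) * (2 * (n * Suc L)) ^ n) (profiles n)"
    using assms by (intro reaches_line) auto
  then show "reaches n (\<lambda>V'. \<exists>F. \<forall>v\<in>V'. line_local_envy_free n v F)
    (2 * (n * Suc n) * (2 * (n * Suc L)) ^ n) (profiles n)"
  proof (rule reaches_weaken)
    fix V' assume "\<exists>A. line_result n n {#(0,1)#} A V'"
    then obtain A where A: "line_result n n {#(0,1)#} A V'" by blast
    have "\<forall>i. \<exists>xs. mset xs = A i" using ex_mset by blast
    then obtain F where "\<And>i. mset (F i) = A i" using choice by metis
    then show "\<exists>F. \<forall>v\<in>V'. line_local_envy_free n v F"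
      using A by (intro exI[of _ F]) (auto simp: line_result_def intro: line_local_envy_freeI)
  qed
qed

section \<open>The query bound\<close>

text \<open>For \<open>n \<ge> 2\<close> this is the solution \<open>e\<close> of
  \<open>n powr ((1 + e) * n) = 4 * n^2 * (n * l)^n\<close> with
  \<open>l = 2 * (log 2 n + 2)\<close>. It vanishes in the limit because \<open>ln l\<close> grows
  only like \<open>ln (ln n)\<close>.\<close>

definition line_exponent :: "nat \<Rightarrow> real" where
  "line_exponent n = (ln (4 * real n ^ 2) + real n * ln (2 * (log 2 n + 2))) / (real n * ln n)"

lemma line_exponent_tendsto: "line_exponent \<longlonglongrightarrow> 0"
  unfolding line_exponent_def by real_asymp

lemma line_cost_le_powr:
  assumes "2 \<le> n"
  shows "real (2 * (n * Suc n) * (2 * (n * Suc (nat \<lceil>log 2 n\<rceil>))) ^ n) \<le>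
    real n powr ((1 + line_exponent n) * real n)"
proof -
  define l where "l = 2 * (log 2 n + 2)"
  have log: "1 \<le> log 2 n"
    using assms by (simp add: le_log_iff)
  then have l: "0 < l"
    by (simp add: l_def)
  \<comment> \<open>One unit accounts for rounding up, the other for \<open>Suc\<close>.\<close>
  from log have L: "real (Suc (nat \<lceil>log 2 n\<rceil>)) \<le> log 2 n + 2"
    by linarith
  have "real (2 * (n * Suc (nat \<lceil>log 2 n\<rceil>))) \<le> real n * l"
    using mult_left_mono[OF L, of "2 * real n"] by (simp add: l_def algebra_simps)
  then have "real (2 * (n * Suc (nat \<lceil>log 2 n\<rceil>))) ^ n \<le> (real n * l) ^ n"
    by (intro power_mono) simp_all
  moreover have "real (2 * (n * Suc n)) \<le> 4 * real n ^ 2"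
  proof -
    have "real n * 1 \<le> real n * real n" using assms by (intro mult_left_mono) auto
    then show ?thesis by (simp add: power2_eq_square algebra_simps)
  qed
  ultimately have "real (2 * (n * Suc n) * (2 * (n * Suc (nat \<lceil>log 2 n\<rceil>))) ^ n) \<le>
      4 * real n ^ 2 * (real n * l) ^ n"
    unfolding of_nat_mult[of "2 * (n * Suc n)"] of_nat_power by (intro mult_mono) simp_all
  also have "\<dots> = exp (ln (4 * real n ^ 2) + real n * (ln n + ln l))"
    using assms l by (simp add: exp_add exp_of_nat_mult)
  also have "ln (4 * real n ^ 2) + real n * (ln n + ln l) = (1 + line_exponent n) * real n * ln n"
    using assms by (simp add: line_exponent_def l_def field_simps)
  also have "exp \<dots> = real n powr ((1 + line_exponent n) * real n)"
    using assms by (simp add: powr_def)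
  finally show ?thesis .
qed

lemma le_two_power_ceiling_log:
  assumes "1 \<le> n"
  shows "n \<le> 2 ^ nat \<lceil>log 2 (real n)\<rceil>"
proof -
  have "real n = 2 powr log 2 n"
    using assms by simp
  also have "\<dots> \<le> 2 powr real (nat \<lceil>log 2 n\<rceil>)"
    by (intro powr_mono real_nat_ceiling_ge) simp
  also have "\<dots> = real (2 ^ nat \<lceil>log 2 n\<rceil>)"
    by (simp add: powr_realpow)
  finally show ?thesis
    unfolding of_nat_le_iff .
qed

theorem theorem1:
  shows "\<exists>\<epsilon> :: nat \<Rightarrow> real. \<epsilon> \<longlonglongrightarrow> 0 \<and>
    (\<forall>n::nat. n \<ge> 1 \<longrightarrow>
      (\<exists>P :: protocol. \<exists>k :: nat. real k \<le> real n powr ((1 + \<epsilon> n) * real n) \<and>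
         (\<forall>v :: nat \<Rightarrow> real \<Rightarrow> real \<Rightarrow> real.
            (\<forall>i<n. valuation (v i)) \<longrightarrow> rw_correct n v P k)))"
proof (intro exI[of _ line_exponent] conjI allI impI line_exponent_tendsto)
  fix n :: nat assume n: "n \<ge> 1"
  show "\<exists>P k. real k \<le> real n powr ((1 + line_exponent n) * real n) \<and>
    (\<forall>v. (\<forall>i<n. valuation (v i)) \<longrightarrow> rw_correct n v P k)"
  proof (cases "n = 1")
    case True
    \<comment> \<open>A single agent takes everything without a query, which meets the bound
      whatever the exponent is at 1.\<close>
    have "line_local_envy_free 1 v (\<lambda>_. [(0,1)])" for v
      by (simp add: line_local_envy_free_def is_allocation_def lessThan_Suc)
    then have "rw_correct n v (Output (\<lambda>_. [(0,1)])) 0" for v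
      unfolding True by (rule rw_correct.out)
    then show ?thesis
      by (intro exI[of _ "Output (\<lambda>_. [(0,1)])"] exI[of _ 0]) simp
  next
    case False
    with n have n2: "2 \<le> n" by simp
    obtain P where "\<forall>v\<in>profiles n.
        rw_correct n v P (2 * (n * Suc n) * (2 * (n * Suc (nat \<lceil>log 2 n\<rceil>))) ^ n)"
      using line_protocol[OF n2 le_two_power_ceiling_log[OF n]] by blast
    then show ?thesis
      using line_cost_le_powr[OF n2] unfolding profiles_def by blast
  qed
qed

end
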